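(* Let $n,m\geq1$, define $m_0$, $H=\mathrm{CK}(n)^*(\mathrm{SO}_m)$, $H_0=\mathrm{CK}(n)^*(\mathrm{SO}_{m_0})$ and $H\to H_0$ as follows: $m_0=m$ if $m\le2^{n+1}$, and for $m>2^{n+1}$, $m_0=2^{n+1}-1$ ($m$ odd) or $m_0=2^{n+1}$ ($m$ even); $H\to H_0$ is pullback along $\mathrm{SO}_{m_0}\hookrightarrow\mathrm{SO}_m$. Let $e_1,\dots,e_s$ ($s=\lfloor\frac{m-1}{2}\rfloor$) be generators of $H$ with $H\cong\mathbb F_2[v_n][e_1,\dots,e_s]/(e_i^2=e_{2i},\ v_ne_i=0\ (i\ge2^n))$ and co-multiplication as in the paper's description of $\mathrm{CK}(n)^*(\mathrm{SO}_m)$ (i.e. $\widetilde\Delta(e_{\langle 2k\rangle})=\sum_{i=0}^{\nu_2(k)}v_n^{i+1}e_{\langle k/2^i\rangle}\otimes e_{\langle k/2^i\rangle}\prod_{j<i}(e_{\langle k/2^j\rangle}\otimes1+1\otimes e_{\langle k/2^j\rangle})$ for $0<k<2^{n-1}$, $\widetilde\Delta(e_{2^n-1})=v_ne_{2^n-1}\otimes e_{2^n-1}$, $\widetilde\Delta(e_{2k-1})=0$ for $k>2^{n-1}$, where $\langle t\rangle=2^n-1-t$, $e_j=0$ for $j>s$). Let $I$ be a homogeneous bi-ideal of $H$ whose image $I_0$ in $H_0$ is saturated. Then, with $r=\lfloor\frac{s+1}{2}\rfloor$, $$I=\big(e_1^{2^{a_1}},e_3^{2^{a_2}},\dots,e_{2r-1}^{2^{a_r}}\big)$$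 for some integers $a_i\geq0$; in particular $I$ is determined by its image modulo $v_n$.
   Context: Base field of characteristic $0$, prime $2$; $\mathrm{CK}(n)^*=\Omega^*\otimes_{\mathbb L}\mathbb F_2[v_n]$ algebraic connective Morava K-theory, $\deg e_i=i$, $|v_n|=1-2^n$; $\mathrm{SO}_m$ split special orthogonal group; Hopf structure via group multiplication; $\widetilde\Delta(x)=\Delta(x)-x\otimes1-1\otimes x$; $\nu_2$ the $2$-adic valuation. A bi-ideal is an ideal $I$ with $\Delta(I)\subseteq I\otimes H+H\otimes I$ and $\varepsilon(I)=0$; an ideal $N$ of an $\mathbb F_2[v_n]$-module is saturated if $v_nx\in N$ implies $x\in N$. *)

theory Defs
  imports "HOL-Library.Poly_Mapping" "HOL-Library.Z2" "HOL-Computational_Algebra.Primes"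
begin

text \<open>Polynomial ring over F_2 in countably many variables X_0, X_1, ... .
  In the ring R = F_2[v_n, e_1, e_2, ...] we let X_0 = v_n and X_i = e_i (i >= 1).
  In the ring T (modelling H tensor_{F_2[v_n]} H) we let X_0 = v_n,
  X_(2i-1) = e_i (x) 1 and X_(2i) = 1 (x) e_i.  Both are the same Isabelle type.\<close>

type_synonym pol = "(nat \<Rightarrow>\<^sub>0 nat) \<Rightarrow>\<^sub>0 bit"

definition var :: "nat \<Rightarrow> pol" where
  "var i = Poly_Mapping.single (Poly_Mapping.single i 1) 1"

definition cst :: "bit \<Rightarrow> pol" where
  "cst c = Poly_Mapping.single 0 c"

definition subst :: "(nat \<Rightarrow> pol) \<Rightarrow> pol \<Rightarrow> pol" where
  "subst sg p = (\<Sum>u\<in>Poly_Mapping.keys p. cst (Poly_Mapping.lookup p u) * (\<Prod>i\<in>Poly_Mapping.keys u. sg i ^ Poly_Mapping.lookup u i))"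

definition is_ideal :: "'a::comm_ring_1 set \<Rightarrow> bool" where
  "is_ideal I \<longleftrightarrow> 0 \<in> I \<and> (\<forall>x\<in>I. \<forall>y\<in>I. x + y \<in> I) \<and> (\<forall>r. \<forall>x\<in>I. r * x \<in> I)"

definition ideal_of :: "'a::comm_ring_1 set \<Rightarrow> 'a set" where
  "ideal_of S = {x. \<exists>F c. finite F \<and> F \<subseteq> S \<and> x = (\<Sum>g\<in>F. c g * g)}"

definition s_of :: "nat \<Rightarrow> nat" where
  "s_of m = (m - 1) div 2"

definition r_of :: "nat \<Rightarrow> nat" where
  "r_of s = (s + 1) div 2"

definition m0_of :: "nat \<Rightarrow> nat \<Rightarrow> nat" where
  "m0_of n m = (if m \<le> 2 ^ (n + 1) then m
                else if odd m then 2 ^ (n + 1) - 1 else 2 ^ (n + 1))"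

definition eR :: "nat \<Rightarrow> nat \<Rightarrow> pol" where
  "eR s j = (if 1 \<le> j \<and> j \<le> s then var j else 0)"

definition rels :: "nat \<Rightarrow> nat \<Rightarrow> pol set" where
  "rels n s = {var i ^ 2 - eR s (2 * i) | i. 1 \<le> i \<and> i \<le> s}
            \<union> {var j | j. j > s}
            \<union> {var 0 * var i | i. 2 ^ n \<le> i \<and> i \<le> s}"

definition JR :: "nat \<Rightarrow> nat \<Rightarrow> pol set" where
  "JR n s = ideal_of (rels n s)"

definition mdeg :: "nat \<Rightarrow> (nat \<Rightarrow>\<^sub>0 nat) \<Rightarrow> int" where
  "mdeg n u = (\<Sum>i\<in>Poly_Mapping.keys u - {0}. int i * int (Poly_Mapping.lookup u i))
              + (1 - 2 ^ n) * int (Poly_Mapping.lookup u 0)"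

definition hcomp :: "nat \<Rightarrow> int \<Rightarrow> pol \<Rightarrow> pol" where
  "hcomp n d p = (\<Sum>u\<in>{u\<in>Poly_Mapping.keys p. mdeg n u = d}. Poly_Mapping.single u (Poly_Mapping.lookup p u))"

definition homogeneous_set :: "nat \<Rightarrow> pol set \<Rightarrow> bool" where
  "homogeneous_set n I \<longleftrightarrow> (\<forall>p\<in>I. \<forall>d. hcomp n d p \<in> I)"

definition iota1 :: "pol \<Rightarrow> pol" where
  "iota1 = subst (\<lambda>i. if i = 0 then var 0 else var (2 * i - 1))"

definition iota2 :: "pol \<Rightarrow> pol" where
  "iota2 = subst (\<lambda>i. if i = 0 then var 0 else var (2 * i))"

definition eL :: "nat \<Rightarrow> nat \<Rightarrow> pol" where
  "eL s t = (if 1 \<le> t \<and> t \<le> s then var (2 * t - 1) else 0)"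

definition eRt :: "nat \<Rightarrow> nat \<Rightarrow> pol" where
  "eRt s t = (if 1 \<le> t \<and> t \<le> s then var (2 * t) else 0)"

definition angle :: "nat \<Rightarrow> nat \<Rightarrow> nat" where
  "angle n t = 2 ^ n - 1 - t"

definition dtilde_odd :: "nat \<Rightarrow> nat \<Rightarrow> nat \<Rightarrow> pol" where
  "dtilde_odd n s i =
    (if i < 2 ^ n - 1 then
       (let k = (2 ^ n - 1 - i) div 2;
            t = (\<lambda>a. angle n (k div 2 ^ a)) in
        \<Sum>a\<in>{0..multiplicity (2::nat) k}.
           var 0 ^ (a + 1) * eL s (t a) * eRt s (t a) *
           (\<Prod>b\<in>{..<a}. eL s (t b) + eRt s (t b)))
     else if i = 2 ^ n - 1 then var 0 * eL s i * eRt s i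
     else 0)"

text \<open>Coproduct of e_i; for even i it is determined by e_i = e_(i/2)^2.\<close>
function delta_e :: "nat \<Rightarrow> nat \<Rightarrow> nat \<Rightarrow> pol" where
  "delta_e n s i =
    (if i = 0 \<or> i > s then 0
     else if even i then (delta_e n s (i div 2)) ^ 2
     else eL s i + eRt s i + dtilde_odd n s i)"
  by pat_completeness auto
termination by (relation "measure (\<lambda>(n, s, i). i)") auto

definition Delta :: "nat \<Rightarrow> nat \<Rightarrow> pol \<Rightarrow> pol" where
  "Delta n s = subst (\<lambda>i. if i = 0 then var 0 else delta_e n s i)"

text \<open>A homogeneous bi-ideal I of H whose image in H_0 is saturated,
  represented by its preimage I in R (an ideal of R containing the relations).
  The map H -> H_0 (pullback along SO_(m_0) -> SO_m) sends e_i to e_i.\<close>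
definition good_ideal :: "nat \<Rightarrow> nat \<Rightarrow> pol set \<Rightarrow> bool" where
  "good_ideal n m I \<longleftrightarrow>
     (let s = s_of m; s0 = s_of (m0_of n m); I0 = ideal_of (I \<union> JR n s0) in
      is_ideal I \<and> JR n s \<subseteq> I
      \<and> homogeneous_set n I
      \<and> Delta n s ` I \<subseteq> ideal_of (iota1 ` I \<union> iota2 ` I)
      \<and> I \<subseteq> ideal_of {var i | i. i \<ge> 1}
      \<and> (\<forall>x. var 0 * x \<in> I0 \<longrightarrow> x \<in> I0))"

end

theory Submission
  imports Defs
begin

text \<open>Modulo \<open>v\<^sub>n\<close> the generators \<open>e\<^sub>i\<close> are primitive and the primitive elements of degree \<open>d\<close> are
  spanned by \<open>e\<^sub>d\<close>, so looking at elements of least degree shows that a homogeneous bi-ideal is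
  generated modulo \<open>v\<^sub>n\<close> by the \<open>e\<^sub>j\<close> it contains. Let \<open>Z\<close> be the set of these \<open>j\<close> for the image
  \<open>I\<^sub>0\<close>. As \<open>I\<^sub>0\<close> is saturated, \<open>H\<^sub>0 / I\<^sub>0\<close> is free over \<open>F\<^sub>2[v\<^sub>n]\<close> on the monomials
  not involving the \<open>e\<^sub>j\<close> with \<open>j \<in> Z\<close>, and so is its tensor square on the products of two such
  monomials. Comparing reduced coproducts in the tensor square shows by descending induction on
  \<open>j \<in> Z\<close> that \<open>e\<^sub>j \<in> I\<^sub>0\<close> exactly, without a correction term divisible by \<open>v\<^sub>n\<close>. The kernel
  of \<open>H \<rightarrow> H\<^sub>0\<close> is killed by \<open>v\<^sub>n\<close>, which allows one to lift the result to \<open>I\<close>.\<close>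

text \<open>Freeness has to be sought in H_0, because v_n kills the e_i with i \<ge> 2^n and H has
  torsion as soon as it contains one. The obstacle is that knowledge modulo v_n gives only e_j + v_n
  y in I_0. Since v_n has negative degree 1 - 2^n, such a y has degree j + 2^n - 1, beyond the index
  of every generator of H_0, and there no normal monomial is primitive modulo v_n. For j = i * 2^a
  with i odd, the reduced coproduct of e_j is the 2^a-th power of that of e_i. For i < 2^n - 1 its
  lowest term in v_n is v_n^(2^a) times e_c tensor e_c, where c = t * 2^a and 2t = 2^n - 1 + i. As t
  > i, the index c exceeds j, which is why the induction descends. The negative degree of v_n also
  decides termination: replacing e_j by v_n y and setting v_n aside raises the degree, and the
  process stops because monomials of large degree vanish.\<close>

abbreviation lookup where "lookup \<equiv> Poly_Mapping.lookup"
abbreviation keys where "keys \<equiv> Poly_Mapping.keys"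
abbreviation single where "single \<equiv> Poly_Mapping.single"

section \<open>The polynomial ring\<close>

definition mon :: "(nat \<Rightarrow>\<^sub>0 nat) \<Rightarrow> pol" where
  "mon u = single u 1"

lemma var_eq_mon: "var i = mon (single i 1)"
  by (simp add: var_def mon_def)

lemma mon_mult: "mon u * mon w = mon (u + w)"
  by (simp add: mon_def mult_single)

lemma mon_zero [simp]: "mon 0 = 1"
  by (simp add: mon_def)

lemma keys_mon [simp]: "keys (mon u) = {u}"
  by (simp add: mon_def)

lemma lookup_mon: "lookup (mon u) w = (if u = w then 1 else 0)"
  by (simp add: mon_def lookup_single when_def)

lemma mon_power: "mon (single i a) ^ k = mon (single i (a * k))"
  by (induct k) (simp_all add: mon_mult single_add[symmetric])

lemma var_power: "var i ^ k = mon (single i k)"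
  by (simp add: var_eq_mon mon_power)

lemma cst_0 [simp]: "cst 0 = 0" and cst_1 [simp]: "cst 1 = 1"
  by (simp_all add: cst_def)

lemma cst_add: "cst (a + b) = cst a + cst b"
  unfolding cst_def by (rule single_add)

lemma bit_cases: "(c::bit) = 0 \<or> c = 1"
  by (cases c) auto

lemma lookup_in_keys: "u \<in> keys p \<Longrightarrow> lookup p u = (1::bit)"
  by (metis bit_cases in_keys_iff)

lemma bit_add_self [simp]: "(c::bit) + c = 0"
  using bit_cases[of c] by auto

lemma add_self [simp]: "(p::pol) + p = 0"
  by (rule poly_mapping_eqI) (simp only: lookup_add bit_add_self lookup_zero)

lemma two_pol [simp]: "(2::pol) = 0"
  using add_self[of 1] by (simp only: one_add_one)

lemma uminus_pol [simp]: "- (p::pol) = p"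
  by (rule minus_unique) simp

lemma diff_pol [simp]: "(p::pol) - q = p + q"
  by (metis uminus_pol diff_conv_add_uminus)

lemma add_self_left [simp]: "(p::pol) + (p + q) = q"
  by (simp add: add.assoc[symmetric])

lemma pol_expand: "p = (\<Sum>u\<in>keys p. mon u)"
proof (rule poly_mapping_eqI)
  fix w
  have "lookup (\<Sum>u\<in>keys p. mon u) w = (\<Sum>u\<in>keys p. if u = w then 1 else 0)"
    by (simp add: lookup_sum lookup_mon)
  also have "\<dots> = (if w \<in> keys p then 1 else 0)"
    by (simp add: sum.delta)
  also have "\<dots> = lookup p w"
    by (metis lookup_in_keys in_keys_iff)
  finally show "lookup p w = lookup (\<Sum>u\<in>keys p. mon u) w" ..
qed

lemma pol_induct [case_names zero mon add]:
  assumes "P 0" "\<And>u. P (mon u)" "\<And>p q. P p \<Longrightarrow> P q \<Longrightarrow> P (p + q)"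
  shows "P p"
proof -
  have "P (\<Sum>u\<in>A. mon u)" if "finite A" for A
    using that by (induct A) (auto intro: assms)
  then show ?thesis by (subst pol_expand) auto
qed

lemma expo_induct [case_names zero add]:
  fixes u :: "nat \<Rightarrow>\<^sub>0 nat"
  assumes "P 0" "\<And>u i. P u \<Longrightarrow> P (u + single i 1)"
  shows "P u"
proof (induct "\<Sum>i\<in>keys u. lookup u i" arbitrary: u rule: less_induct)
  case less
  show ?case
  proof (cases "u = 0")
    case False
    then obtain i where i: "i \<in> keys u" by (metis keys_eq_empty ex_in_conv)
    define w where "w = u - single i 1"
    have pos: "lookup u i > 0" using i by (simp add: in_keys_iff)
    have u: "u = w + single i 1"
      by (rule poly_mapping_eqI) (use pos in \<open>auto simp: w_def lookup_add lookup_minus lookup_single when_def\<close>)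
    have lw: "lookup w j = lookup u j - (if i = j then 1 else 0)" for j
      by (simp add: w_def lookup_minus lookup_single when_def)
    have sub: "keys w \<subseteq> keys u" by (auto simp: in_keys_iff lw)
    have "(\<Sum>j\<in>keys w. lookup w j) \<le> (\<Sum>j\<in>keys u. lookup w j)"
      by (rule sum_mono2) (use sub in auto)
    also have "\<dots> < (\<Sum>j\<in>keys u. lookup u j)"
      by (rule sum_strict_mono_ex1) (use i pos in \<open>auto simp: lw intro!: bexI[of _ i]\<close>)
    finally have "P w" by (rule less)
    then show ?thesis by (subst u) (rule assms(2))
  qed (use assms in simp)
qed

lemma pol_ring_induct [case_names zero one var add mult]:
  assumes "P 0" "P 1" "\<And>i. P (var i)" "\<And>p q. P p \<Longrightarrow> P q \<Longrightarrow> P (p + q)"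
    "\<And>p q. P p \<Longrightarrow> P q \<Longrightarrow> P (p * q)"
  shows "P p"
proof (induct p rule: pol_induct)
  case (mon u)
  show ?case
    by (induct u rule: expo_induct)
      (use assms in \<open>auto simp: mon_mult[symmetric] var_eq_mon\<close>)
qed (use assms in auto)

section \<open>Additive maps and substitutions\<close>

definition additive :: "(pol \<Rightarrow> pol) \<Rightarrow> bool" where
  "additive f \<longleftrightarrow> (\<forall>p q. f (p + q) = f p + f q)"

lemma additiveD: "additive f \<Longrightarrow> f (p + q) = f p + f q"
  by (simp add: additive_def)

lemma additive_0: "additive f \<Longrightarrow> f 0 = 0"
  by (metis additiveD add_self)

lemma additive_sum: "additive f \<Longrightarrow> f (\<Sum>x\<in>A. g x) = (\<Sum>x\<in>A. f (g x))"
  by (induct A rule: infinite_finite_induct) (auto simp: additive_0 additiveD)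

text \<open>The F_2-linear extension of a map on exponents. Substitutions, coefficient filters and
  tensor products of maps are all instances, so they share one proof of additivity.\<close>

definition lin :: "((nat \<Rightarrow>\<^sub>0 nat) \<Rightarrow> pol) \<Rightarrow> pol \<Rightarrow> pol" where
  "lin F p = (\<Sum>u\<in>keys p. cst (lookup p u) * F u)"

lemma lin_superset: "finite A \<Longrightarrow> keys p \<subseteq> A \<Longrightarrow> lin F p = (\<Sum>u\<in>A. cst (lookup p u) * F u)"
  unfolding lin_def by (rule sum.mono_neutral_left) (auto simp: in_keys_iff)

lemma lin_add: "lin F (p + q) = lin F p + lin F q"
proof -
  let ?A = "keys p \<union> keys q"
  have "keys (p + q) \<subseteq> ?A" by (rule keys_add)
  then show ?thesis
    by (simp only: lin_superset[of ?A] finite_UnI finite_keys lookup_add cst_add distrib_right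
        sum.distrib Un_upper1 Un_upper2)
qed

lemma additive_lin [simp]: "additive (lin F)"
  by (simp add: additive_def lin_add)

lemma lin_mon [simp]: "lin F (mon u) = F u"
  by (simp add: lin_def lookup_mon)

definition expo_eval :: "(nat \<Rightarrow> pol) \<Rightarrow> (nat \<Rightarrow>\<^sub>0 nat) \<Rightarrow> pol" where
  "expo_eval sg u = (\<Prod>i\<in>keys u. sg i ^ lookup u i)"

lemma expo_eval_superset:
  "finite A \<Longrightarrow> keys u \<subseteq> A \<Longrightarrow> expo_eval sg u = (\<Prod>i\<in>A. sg i ^ lookup u i)"
  unfolding expo_eval_def by (rule prod.mono_neutral_left) (auto simp: in_keys_iff)

lemma expo_eval_add: "expo_eval sg (u + w) = expo_eval sg u * expo_eval sg w"
proof -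
  let ?A = "keys u \<union> keys w"
  have "keys (u + w) \<subseteq> ?A" by (rule keys_add)
  then show ?thesis
    by (simp add: expo_eval_superset[of ?A] lookup_add power_add prod.distrib)
qed

lemma subst_eq_lin: "subst sg = lin (expo_eval sg)"
  by (simp add: fun_eq_iff subst_def lin_def expo_eval_def)

lemma additive_subst [simp]: "additive (subst sg)"
  by (simp add: subst_eq_lin)

lemma subst_mon: "subst sg (mon u) = expo_eval sg u"
  by (simp add: subst_eq_lin)

lemma subst_add: "subst sg (p + q) = subst sg p + subst sg q"
  by (simp add: subst_eq_lin lin_add)

lemma subst_0 [simp]: "subst sg 0 = 0"
  by (rule additive_0) simp

lemma subst_1 [simp]: "subst sg 1 = 1"
  using subst_mon[of sg 0] by (simp add: expo_eval_def)

lemma subst_var [simp]: "subst sg (var i) = sg i"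
  by (simp add: var_eq_mon subst_mon expo_eval_def)

lemma subst_mult: "subst sg (p * q) = subst sg p * subst sg q"
proof (induct p rule: pol_induct)
  case (mon u)
  show ?case
    by (induct q rule: pol_induct)
      (simp_all add: mon_mult subst_mon expo_eval_add distrib_left subst_add)
qed (simp_all add: distrib_right subst_add)

lemma subst_power: "subst sg (p ^ k) = subst sg p ^ k"
  by (induct k) (simp_all add: subst_mult)

lemma subst_mon_split: "subst sg (mon (u + single i k)) = subst sg (mon u) * sg i ^ k"
  by (simp add: mon_mult[symmetric] var_power[symmetric] subst_mult subst_power)

lemma frobenius: "((p::pol) + q) ^ (2 ^ a) = p ^ (2 ^ a) + q ^ (2 ^ a)"
proof (induct a)
  case (Suc a)
  have "(x + y)^2 = x^2 + y^2" for x y :: pol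
    by (simp add: power2_eq_square distrib_left distrib_right mult.commute)
  then have "((p + q) ^ 2 ^ a)\<^sup>2 = (p ^ 2 ^ a)\<^sup>2 + (q ^ 2 ^ a)\<^sup>2"
    by (simp only: Suc)
  then show ?case
    by (simp add: power_mult[symmetric] mult.commute)
qed simp

lemma square_add: "((p::pol) + q)\<^sup>2 = p\<^sup>2 + q\<^sup>2"
  using frobenius[of p q 1] by simp

definition filt :: "((nat \<Rightarrow>\<^sub>0 nat) \<Rightarrow> bool) \<Rightarrow> pol \<Rightarrow> pol" where
  "filt P = lin (\<lambda>u. if P u then mon u else 0)"

lemma additive_filt [simp]: "additive (filt P)"
  by (simp add: filt_def)

lemma filt_mon: "filt P (mon u) = (if P u then mon u else 0)"
  by (simp add: filt_def)

lemma lookup_filt: "lookup (filt P p) u = (if P u then lookup p u else 0)"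
  by (induct p rule: pol_induct)
    (auto simp: additive_0 additiveD filt_mon lookup_add lookup_mon)

lemma keys_filt: "keys (filt P p) = {u \<in> keys p. P u}"
  by (auto simp: in_keys_iff lookup_filt split: if_splits)

lemma filt_split: "p = filt P p + filt (\<lambda>u. \<not> P u) p"
  by (rule poly_mapping_eqI) (simp add: lookup_add lookup_filt)

lemma filt_id: "(\<And>u. u \<in> keys p \<Longrightarrow> P u) \<Longrightarrow> filt P p = p"
  by (rule poly_mapping_eqI) (metis lookup_filt in_keys_iff)

lemma hcomp_eq_filt: "hcomp n d = filt (\<lambda>u. mdeg n u = d)"
proof
  fix p
  have "hcomp n d p = (\<Sum>u\<in>keys p. if mdeg n u = d then mon u else 0)"
    unfolding hcomp_def
    by (subst sum.inter_filter[symmetric]) (auto simp: mon_def lookup_in_keys intro!: sum.cong)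
  also have "\<dots> = filt (\<lambda>u. mdeg n u = d) p"
    by (auto simp: filt_def lin_def lookup_in_keys intro!: sum.cong)
  finally show "hcomp n d p = filt (\<lambda>u. mdeg n u = d) p" .
qed

section \<open>Ideals\<close>

lemma is_ideal_0: "is_ideal I \<Longrightarrow> 0 \<in> I"
  and is_ideal_add: "is_ideal I \<Longrightarrow> x \<in> I \<Longrightarrow> y \<in> I \<Longrightarrow> x + y \<in> I"
  and is_ideal_mult: "is_ideal I \<Longrightarrow> x \<in> I \<Longrightarrow> r * x \<in> I"
  and is_ideal_mult_right: "is_ideal I \<Longrightarrow> x \<in> I \<Longrightarrow> x * r \<in> I"
  by (auto simp: is_ideal_def mult.commute[of x r])

lemma is_ideal_sum: "is_ideal I \<Longrightarrow> (\<And>x. x \<in> A \<Longrightarrow> f x \<in> I) \<Longrightarrow> sum f A \<in> I"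
  by (induct A rule: infinite_finite_induct) (auto simp: is_ideal_0 is_ideal_add)

lemma is_ideal_add_cancel: "is_ideal I \<Longrightarrow> (x::pol) + y \<in> I \<Longrightarrow> y \<in> I \<Longrightarrow> x \<in> I"
  using is_ideal_add[of I "x + y" y] by (simp add: add.assoc)

lemma is_ideal_add_cancel_left: "is_ideal I \<Longrightarrow> (x::pol) + y \<in> I \<Longrightarrow> x \<in> I \<Longrightarrow> y \<in> I"
  using is_ideal_add_cancel[of I y x] by (simp add: add.commute)

lemma ideal_of_subset: "S \<subseteq> ideal_of S"
proof
  fix x assume "x \<in> S"
  then show "x \<in> ideal_of S"
    unfolding ideal_of_def by (intro CollectI exI[of _ "{x}"] exI[of _ "\<lambda>_. 1"]) auto
qed

lemma is_ideal_ideal_of [simp]: "is_ideal (ideal_of S)"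
  unfolding is_ideal_def
proof (intro conjI ballI allI)
  show "0 \<in> ideal_of S" unfolding ideal_of_def by (intro CollectI exI[of _ "{}"]) auto
next
  fix x y assume "x \<in> ideal_of S" "y \<in> ideal_of S"
  then obtain F c G d where F: "finite F" "F \<subseteq> S" "x = (\<Sum>g\<in>F. c g * g)"
    and G: "finite G" "G \<subseteq> S" "y = (\<Sum>g\<in>G. d g * g)"
    unfolding ideal_of_def by auto
  have "x = (\<Sum>g\<in>F \<union> G. (if g \<in> F then c g else 0) * g)"
    unfolding F by (rule sum.mono_neutral_cong_left) (use F G in auto)
  moreover have "y = (\<Sum>g\<in>F \<union> G. (if g \<in> G then d g else 0) * g)"
    unfolding G by (rule sum.mono_neutral_cong_left) (use F G in auto)
  ultimately have "x + y = (\<Sum>g\<in>F \<union> G. ((if g \<in> F then c g else 0) + (if g \<in> G then d g else 0)) * g)"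
    by (simp add: distrib_right sum.distrib)
  then show "x + y \<in> ideal_of S"
    unfolding ideal_of_def
    by (intro CollectI exI[of _ "F \<union> G"]
        exI[of _ "\<lambda>g. (if g \<in> F then c g else 0) + (if g \<in> G then d g else 0)"]) (use F G in auto)
next
  fix r x assume "x \<in> ideal_of S"
  then obtain F c where F: "finite F" "F \<subseteq> S" "x = (\<Sum>g\<in>F. c g * g)"
    unfolding ideal_of_def by auto
  then show "r * x \<in> ideal_of S"
    unfolding ideal_of_def
    by (intro CollectI exI[of _ F] exI[of _ "\<lambda>g. r * c g"]) (auto simp: sum_distrib_left mult.assoc)
qed

lemma ideal_of_additive_induct [consumes 1, case_names zero add mult]:
  assumes "x \<in> ideal_of S" "P 0" "\<And>x y. P x \<Longrightarrow> P y \<Longrightarrow> P (x + y)"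
    "\<And>c g. g \<in> S \<Longrightarrow> P (c * g)"
  shows "P x"
proof -
  obtain F c where F: "finite F" "F \<subseteq> S" "x = (\<Sum>g\<in>F. c g * g)"
    using assms(1) unfolding ideal_of_def by auto
  have "P (\<Sum>g\<in>F. c g * g)" using F(1,2) by (induct F) (auto intro: assms)
  then show ?thesis using F by simp
qed

lemma ideal_of_least: "is_ideal J \<Longrightarrow> S \<subseteq> J \<Longrightarrow> ideal_of S \<subseteq> J"
  by (auto elim!: ideal_of_additive_induct intro: is_ideal_0 is_ideal_add is_ideal_mult)

lemma ideal_of_mono: "S \<subseteq> ideal_of S' \<Longrightarrow> ideal_of S \<subseteq> ideal_of S'"
  by (rule ideal_of_least) simp_all

lemma ideal_of_insert_decomp:
  assumes "is_ideal I" "x \<in> ideal_of (I \<union> {g})"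
  obtains i y where "i \<in> I" "x = i + g * y"
proof -
  have "\<exists>i y. i \<in> I \<and> x = i + g * y"
    using assms(2)
  proof (induct rule: ideal_of_additive_induct)
    case zero
    show ?case using is_ideal_0[OF assms(1)] by (intro exI[of _ 0]) auto
  next
    case (add x y)
    then obtain i a j b where *: "i \<in> I" "j \<in> I" "x = i + g * a" "y = j + g * b" by auto
    then show ?case
      by (intro exI[of _ "i + j"] exI[of _ "a + b"]) (auto simp: is_ideal_add[OF assms(1)] algebra_simps)
  next
    case (mult c h)
    show ?case
    proof (cases "h \<in> I")
      case True
      then show ?thesis
        by (intro exI[of _ "c * h"] exI[of _ 0]) (auto simp: is_ideal_mult[OF assms(1)])
    next
      case False
      then show ?thesis using mult is_ideal_0[OF assms(1)]
        by (intro exI[of _ 0] exI[of _ c]) (auto simp: mult.commute)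
    qed
  qed
  with that show ?thesis by blast
qed

lemma is_ideal_subst_vimage: "is_ideal J \<Longrightarrow> is_ideal {x. subst sg x \<in> J}"
  by (auto simp: is_ideal_def subst_add subst_mult)

lemma is_ideal_quotient: "is_ideal J \<Longrightarrow> is_ideal {x. c * x \<in> J}"
  by (auto simp: is_ideal_def distrib_left mult.left_commute)

lemma subst_ideal_of:
  "is_ideal J \<Longrightarrow> (\<And>g. g \<in> S \<Longrightarrow> subst sg g \<in> J) \<Longrightarrow> x \<in> ideal_of S \<Longrightarrow> subst sg x \<in> J"
  using ideal_of_least[OF is_ideal_subst_vimage, of J S sg] by blast

text \<open>The polynomials on which two substitutions agree modulo \<open>J\<close> are closed
  under sums and products. This is how the coproduct gets replaced by \<open>delta\<close>, and a
  polynomial by its reduction \<open>sred\<close>.\<close>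

lemma subst_cong_ideal:
  assumes J: "is_ideal J" and *: "\<And>i. sg i + tau i \<in> J"
  shows "subst sg p + subst tau p \<in> J"
proof (induct p rule: pol_ring_induct)
  case (add p q)
  have "subst sg (p + q) + subst tau (p + q) = (subst sg p + subst tau p) + (subst sg q + subst tau q)"
    by (simp add: subst_add algebra_simps)
  then show ?case using add by (simp add: is_ideal_add[OF J])
next
  case (mult p q)
  have "subst sg (p * q) + subst tau (p * q)
      = (subst sg p + subst tau p) * subst sg q + subst tau p * (subst sg q + subst tau q)"
    by (simp add: subst_mult algebra_simps)
  then show ?case using mult
    by (simp add: is_ideal_add[OF J] is_ideal_mult[OF J] is_ideal_mult_right[OF J])
qed (use assms in \<open>simp_all add: is_ideal_0\<close>)

lemma mon_mem_ideal_of_var_power: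
  assumes J: "is_ideal J" "var i ^ k \<in> J" and "k \<le> lookup u i"
  shows "mon u \<in> J"
proof -
  have "u = (u - single i k) + single i k"
    by (rule poly_mapping_eqI)
      (use assms(3) in \<open>auto simp: lookup_add lookup_minus lookup_single when_def\<close>)
  then have "mon u = mon (u - single i k) * var i ^ k"
    by (metis mon_mult var_power)
  then show ?thesis using is_ideal_mult[OF J] by simp
qed

section \<open>Degrees\<close>

definition wt :: "nat \<Rightarrow> nat \<Rightarrow> int" where
  "wt n i = (if i = 0 then 1 - 2 ^ n else int i)"

lemma mdeg_eq: "mdeg n u = (\<Sum>i\<in>keys u. wt n i * int (lookup u i))"
proof (cases "0 \<in> keys u")
  case True
  then show ?thesis
    by (simp add: mdeg_def sum.remove[of "keys u" 0] wt_def)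
next
  case False
  then have "lookup u 0 = 0" by (simp add: in_keys_iff)
  with False show ?thesis
    by (auto simp: mdeg_def wt_def intro!: sum.cong)
qed

lemma mdeg_superset:
  "finite A \<Longrightarrow> keys u \<subseteq> A \<Longrightarrow> mdeg n u = (\<Sum>i\<in>A. wt n i * int (lookup u i))"
  unfolding mdeg_eq by (rule sum.mono_neutral_left) (auto simp: in_keys_iff)

lemma mdeg_add: "mdeg n (u + w) = mdeg n u + mdeg n w"
proof -
  let ?A = "keys u \<union> keys w"
  have "keys (u + w) \<subseteq> ?A" by (rule keys_add)
  then show ?thesis
    by (simp add: mdeg_superset[of ?A] lookup_add distrib_left sum.distrib)
qed

lemma mdeg_zero [simp]: "mdeg n 0 = 0"
  by (simp add: mdeg_eq)

lemma mdeg_single: "mdeg n (single i k) = wt n i * int k"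
  by (simp add: mdeg_eq)

lemma additive_hcomp [simp]: "additive (hcomp n d)"
  by (simp add: hcomp_eq_filt)

lemma hcomp_add: "hcomp n d (p + q) = hcomp n d p + hcomp n d q"
  by (simp add: additiveD)

lemma hcomp_0 [simp]: "hcomp n d 0 = 0"
  by (simp add: additive_0)

lemma hcomp_mon: "hcomp n d (mon u) = (if mdeg n u = d then mon u else 0)"
  by (simp add: hcomp_eq_filt filt_mon)

lemma keys_hcomp: "keys (hcomp n d p) = {u \<in> keys p. mdeg n u = d}"
  by (simp add: hcomp_eq_filt keys_filt)

lemma hcomp_mon_mult: "hcomp n d (mon w * p) = mon w * hcomp n (d - mdeg n w) p"
  by (induct p rule: pol_induct)
    (auto simp: hcomp_mon mon_mult mdeg_add distrib_left hcomp_add)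

lemma mdeg_var: "i \<ge> 1 \<Longrightarrow> mdeg n (single i k) = int i * int k"
  by (simp add: mdeg_single wt_def)

text \<open>Multiplication by a monomial only shifts degrees, so components need to be checked on
  generators alone.\<close>

lemma homogeneous_ideal_of:
  assumes "\<And>g d. g \<in> S \<Longrightarrow> hcomp n d g \<in> ideal_of S"
  shows "homogeneous_set n (ideal_of S)"
proof -
  have "hcomp n d (c * g) \<in> ideal_of S" if "g \<in> S" for c g d
  proof (induct c rule: pol_induct)
    case (mon u)
    then show ?case
      by (simp add: hcomp_mon_mult is_ideal_mult[OF is_ideal_ideal_of assms[OF that]])
  qed (auto simp: is_ideal_0 is_ideal_add distrib_right hcomp_add)
  note * = this
  have "hcomp n d p \<in> ideal_of S" if "p \<in> ideal_of S" for p d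
    using that
    by (induct p rule: ideal_of_additive_induct) (simp_all add: * is_ideal_0 is_ideal_add hcomp_add)
  then show ?thesis by (simp add: homogeneous_set_def)
qed

section \<open>Eliminating the generators of even index\<close>

definition opart :: "nat \<Rightarrow> nat" where
  "opart i = i div 2 ^ multiplicity 2 i"

definition epart :: "nat \<Rightarrow> nat" where
  "epart i = multiplicity 2 i"

lemma opart_epart: "i \<ge> 1 \<Longrightarrow> opart i * 2 ^ epart i = i"
  by (simp add: opart_def epart_def multiplicity_dvd)

lemma odd_opart: "i \<ge> 1 \<Longrightarrow> odd (opart i)"
  unfolding opart_def using multiplicity_decompose[of i 2] by simp

lemma odd_pow_mult_eq:
  assumes "odd o1" "odd (o2::nat)" "o1 * 2 ^ a = o2 * 2 ^ b"
  shows "o1 = o2 \<and> a = b"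
proof -
  have False if "odd x" "odd y" "x * 2 ^ c = y * 2 ^ d" "c < d" for x y c d :: nat
  proof -
    have "2 ^ d = 2 ^ c * (2::nat) ^ (d - c)" using that by (simp flip: power_add)
    with that have "x = y * 2 ^ (d - c)" by simp
    with that show False by simp
  qed
  with assms have "a = b" by (metis linorder_neqE_nat)
  with assms show ?thesis by simp
qed

text \<open>In H one has e_i = e_o^(2^a) for i = o * 2^a with o odd, so the odd generators suffice.
  No truncation at s takes place here, so that one substitution serves the ideals over H and over
  H_0 alike. Index 0 is v_n and stays fixed.\<close>

definition sred_img :: "nat \<Rightarrow> pol" where
  "sred_img i = (if i = 0 then var 0 else var (opart i) ^ (2 ^ epart i))"

definition sred :: "pol \<Rightarrow> pol" where
  "sred = subst sred_img"

text \<open>The relation e_i^2 = e_(2i) without the bound s: an index above s causes no trouble,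
  since that variable is itself a relation. Every ideal containing some \<open>JR n s\<close>
  therefore qualifies.\<close>

definition dbl_closed :: "pol set \<Rightarrow> bool" where
  "dbl_closed J \<longleftrightarrow> is_ideal J \<and> (\<forall>i\<ge>1. var i ^ 2 + var (2 * i) \<in> J)"

lemma dbl_closed_power:
  assumes "dbl_closed J" "i \<ge> 1"
  shows "var i ^ (2 ^ a) + var (i * 2 ^ a) \<in> J"
proof (induct a)
  case 0
  then show ?case using assms by (simp add: dbl_closed_def is_ideal_0)
next
  case (Suc a)
  have J: "is_ideal J" using assms by (simp add: dbl_closed_def)
  have 1: "(var i ^ (2 ^ a) + var (i * 2 ^ a))\<^sup>2 \<in> J"
    using Suc by (simp add: power2_eq_square is_ideal_mult[OF J])
  have 2: "var (i * 2 ^ a) ^ 2 + var (2 * (i * 2 ^ a)) \<in> J"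
    using assms by (simp add: dbl_closed_def)
  have "var i ^ (2 ^ Suc a) + var (i * 2 ^ Suc a)
      = (var i ^ (2 ^ a) + var (i * 2 ^ a))\<^sup>2 + (var (i * 2 ^ a) ^ 2 + var (2 * (i * 2 ^ a)))"
    by (simp add: square_add power_mult[symmetric] algebra_simps)
  then show ?case using is_ideal_add[OF J 1 2] by simp
qed

lemma dbl_closed_var_iff:
  assumes "dbl_closed J" "i \<ge> 1"
  shows "var i ^ (2 ^ a) \<in> J \<longleftrightarrow> var (i * 2 ^ a) \<in> J"
  using dbl_closed_power[OF assms, of a] assms is_ideal_add_cancel is_ideal_add_cancel_left
  unfolding dbl_closed_def by blast

lemma sred_cong:
  assumes "dbl_closed J"
  shows "p + sred p \<in> J"
proof -
  have J: "is_ideal J" using assms by (simp add: dbl_closed_def)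
  have "subst var p + subst sred_img p \<in> J"
  proof (rule subst_cong_ideal[OF J])
    fix i
    show "var i + sred_img i \<in> J"
    proof (cases "i = 0")
      case False
      then have "opart i \<ge> 1" using odd_opart[of i] by (cases "opart i") auto
      then show ?thesis
        using dbl_closed_power[OF assms, of "opart i" "epart i"] False
        by (simp add: sred_img_def opart_epart add.commute)
    qed (simp add: sred_img_def is_ideal_0[OF J])
  qed
  moreover have "subst var p = p"
    by (induct p rule: pol_ring_induct) (simp_all add: subst_add subst_mult)
  ultimately show ?thesis by (simp add: sred_def)
qed

lemma sred_mem_iff: "dbl_closed J \<Longrightarrow> sred p \<in> J \<longleftrightarrow> p \<in> J"
  using sred_cong[of J p] is_ideal_add_cancel is_ideal_add_cancel_left
  unfolding dbl_closed_def by blast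

definition odd_expo :: "(nat \<Rightarrow>\<^sub>0 nat) \<Rightarrow> bool" where
  "odd_expo u \<longleftrightarrow> (\<forall>i\<in>keys u. i = 0 \<or> odd i)"

lemma odd_expo_add: "odd_expo (u + w) \<longleftrightarrow> odd_expo u \<and> odd_expo w"
  unfolding odd_expo_def Ball_def in_keys_iff by (auto simp: lookup_add)

text \<open>Each variable turns into a power of a single variable of the same total degree, so
  monomials stay monomials, and neither the grading nor the exponent of v_n is disturbed.\<close>

lemma sred_mon:
  "\<exists>w. sred (mon u) = mon w \<and> odd_expo w \<and> lookup w 0 = lookup u 0 \<and> mdeg n w = mdeg n u"
proof (induct u rule: expo_induct)
  case zero
  show ?case by (rule exI[of _ 0]) (simp add: sred_def odd_expo_def)
next
  case (add u i)
  then obtain w where w: "sred (mon u) = mon w" "odd_expo w" "lookup w 0 = lookup u 0"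
    "mdeg n w = mdeg n u" by blast
  define x :: "nat \<Rightarrow>\<^sub>0 nat" where "x = (if i = 0 then single 0 1 else single (opart i) (2 ^ epart i))"
  have o: "i \<noteq> 0 \<Longrightarrow> odd (opart i)" using odd_opart[of i] by simp
  then have o0: "i \<noteq> 0 \<Longrightarrow> opart i \<noteq> 0" by (metis dvd_0_right)
  have "sred (mon (u + single i 1)) = mon w * sred_img i"
    using w(1) by (simp add: sred_def subst_mon_split)
  also have "sred_img i = mon x"
    using var_power[of "opart i" "2 ^ epart i"] by (simp add: sred_img_def x_def var_eq_mon[of 0])
  finally have 1: "sred (mon (u + single i 1)) = mon (w + x)" by (simp add: mon_mult)
  have 2: "odd_expo x" using o by (auto simp: odd_expo_def x_def)
  have 3: "lookup x 0 = lookup (single i 1) 0"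
    using o0 by (cases "i = 0") (auto simp: x_def lookup_single when_def)
  have "int (opart i) * 2 ^ epart i = int i" if "i \<noteq> 0"
    using opart_epart[of i] that by (metis One_nat_def Suc_leI neq0_conv of_nat_mult of_nat_numeral of_nat_power)
  then have 4: "mdeg n x = mdeg n (single i 1)"
    using o0 by (cases "i = 0") (auto simp: x_def mdeg_single wt_def)
  show ?case
    using w 1 2 3 4 by (intro exI[of _ "w + x"]) (auto simp: odd_expo_add lookup_add mdeg_add)
qed

lemma keys_sred: "u \<in> keys (sred p) \<Longrightarrow> odd_expo u"
proof (induct p arbitrary: u rule: pol_induct)
  case (mon w)
  then show ?case using sred_mon[of w 0] by (metis keys_mon singletonD)
next
  case (add p q)
  then show ?case using keys_add[of "sred p" "sred q"] by (auto simp: sred_def subst_add)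
qed (simp add: sred_def)

lemma opart_odd: "odd i \<Longrightarrow> opart i = i" and epart_odd: "odd i \<Longrightarrow> epart i = 0"
  by (simp_all add: opart_def epart_def not_dvd_imp_multiplicity_0)

lemma sred_mon_id: "odd_expo u \<Longrightarrow> sred (mon u) = mon u"
proof (induct u rule: expo_induct)
  case (add u i)
  then have "sred (mon u) = mon u" "i = 0 \<or> odd i"
    by (auto simp: odd_expo_add) (auto simp: odd_expo_def)
  then show ?case
    by (auto simp: sred_def subst_mon_split sred_img_def opart_odd epart_odd var_eq_mon mon_mult)
qed (simp add: sred_def)

lemma sred_id:
  assumes "\<And>u. u \<in> keys p \<Longrightarrow> odd_expo u"
  shows "sred p = p"
proof -
  have "sred p = (\<Sum>u\<in>keys p. sred (mon u))"
    by (subst pol_expand) (simp add: sred_def additive_sum)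
  also have "\<dots> = p" by (simp add: sred_mon_id assms pol_expand[symmetric])
  finally show ?thesis .
qed

lemma sred_add: "sred (p + q) = sred p + sred q"
  and sred_mult: "sred (p * q) = sred p * sred q"
  and sred_var0: "sred (var 0) = var 0"
  by (simp_all add: sred_def subst_add subst_mult sred_img_def)

text \<open>The exponents outside the monomial ideal generated by the
  \<open>e\<^sub>o ^ (2 ^ a)\<close> with \<open>o\<close> odd and \<open>o * 2 ^ a \<in> Z\<close>.\<close>

definition normal :: "nat set \<Rightarrow> (nat \<Rightarrow>\<^sub>0 nat) \<Rightarrow> bool" where
  "normal Z u \<longleftrightarrow> odd_expo u \<and> (\<forall>i a. odd i \<longrightarrow> i * 2 ^ a \<in> Z \<longrightarrow> lookup u i < 2 ^ a)"

lemma normal_addD: "normal Z (u + w) \<Longrightarrow> normal Z u \<and> normal Z w"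
  by (force simp: normal_def odd_expo_add lookup_add)

lemma normal_add_v: "normal Z (u + single 0 k) \<longleftrightarrow> normal Z u"
proof -
  have "odd_expo (single 0 k)" by (simp add: odd_expo_def)
  moreover have "odd i \<Longrightarrow> lookup (single 0 k) i = 0" for i :: nat
    by (auto simp: lookup_single when_def)
  ultimately show ?thesis by (simp add: normal_def odd_expo_add lookup_add)
qed

lemma not_normal_mem:
  assumes J: "dbl_closed J" and "odd_expo u" "\<not> normal Z u" "\<And>j. j \<in> Z \<Longrightarrow> var j \<in> J"
  shows "mon u \<in> J"
proof -
  obtain i a where ia: "odd i" "i * 2 ^ a \<in> Z" "2 ^ a \<le> lookup u i"
    using assms by (auto simp: normal_def not_less)
  then have "i \<ge> 1" by (cases i) auto
  then have "var i ^ (2 ^ a) \<in> J"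
    using ia assms(4) dbl_closed_var_iff[OF J] by blast
  then show ?thesis
    using mon_mem_ideal_of_var_power ia J by (auto simp: dbl_closed_def)
qed

section \<open>Divisibility by the first variable\<close>

lemma lookup_v_mult: "lookup (var 0 * p) (u + single 0 1) = lookup p u"
  by (induct p rule: pol_induct)
    (auto simp: distrib_left lookup_add var_eq_mon mon_mult lookup_mon add.commute)

lemma lookup_v_mult_0: "lookup u 0 = 0 \<Longrightarrow> lookup (var 0 * p) u = 0"
  by (induct p rule: pol_induct)
    (auto simp: distrib_left lookup_add var_eq_mon mon_mult lookup_mon)

lemma var_nonzero [simp]: "var i \<noteq> 0"
  by (metis keys_mon keys_zero insert_not_empty var_eq_mon)

lemma mon_v_factor: "lookup u 0 \<noteq> 0 \<Longrightarrow> mon u = var 0 * mon (u - single 0 1)"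
proof -
  assume "lookup u 0 \<noteq> 0"
  then have "u = single 0 1 + (u - single 0 1)"
    by (intro poly_mapping_eqI) (auto simp: lookup_add lookup_minus lookup_single when_def)
  then show ?thesis by (metis mon_mult var_eq_mon)
qed

lemma v_dvdI: "(\<And>u. u \<in> keys p \<Longrightarrow> lookup u 0 \<noteq> 0) \<Longrightarrow> \<exists>q. p = var 0 * q"
proof -
  assume "\<And>u. u \<in> keys p \<Longrightarrow> lookup u 0 \<noteq> 0"
  then have "p = (\<Sum>u\<in>keys p. var 0 * mon (u - single 0 1))"
    by (subst pol_expand) (auto intro!: sum.cong simp: mon_v_factor)
  then show ?thesis by (metis sum_distrib_left)
qed

lemma keys_v_mult: "u \<in> keys p \<longleftrightarrow> u + single 0 1 \<in> keys (var 0 * p)"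
  by (simp only: in_keys_iff lookup_v_mult)

lemma keys_v_power: "u \<in> keys p \<longleftrightarrow> u + single 0 k \<in> keys (var 0 ^ k * p)"
proof (induct k)
  case (Suc k)
  have "u + single 0 (Suc k) = (u + single 0 k) + single 0 1"
    by (simp add: add.assoc single_add[symmetric])
  then show ?case by (simp only: Suc keys_v_mult[symmetric] power_Suc mult.assoc)
qed simp

lemma v_factor:
  assumes "p \<noteq> 0"
  obtains b q u where "p = var 0 ^ b * q" "u \<in> keys q" "lookup u 0 = 0"
proof -
  have "\<exists>b q u. p = var 0 ^ b * q \<and> u \<in> keys q \<and> lookup u 0 = 0"
    if "w \<in> keys p" for w
    using that
  proof (induct "lookup w 0" arbitrary: p w)
    case 0
    then show ?case by (intro exI[of _ 0] exI[of _ p] exI[of _ w]) auto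
  next
    case (Suc k)
    show ?case
    proof (cases "\<forall>u\<in>keys p. lookup u 0 \<noteq> 0")
      case True
      then obtain q where q: "p = var 0 * q" using v_dvdI by blast
      have "w = (w - single 0 1) + single 0 1"
        using Suc(2) by (intro poly_mapping_eqI) (auto simp: lookup_add lookup_minus lookup_single when_def)
      then have "w - single 0 1 \<in> keys q" using Suc(3) q keys_v_mult by metis
      moreover have "k = lookup (w - single 0 1) 0" using Suc(2)[symmetric] by (simp add: lookup_minus)
      ultimately obtain b r u where "q = var 0 ^ b * r" "u \<in> keys r" "lookup u 0 = 0"
        using Suc(1) by blast
      then show ?thesis using q by (intro exI[of _ "Suc b"]) (auto simp: mult.assoc)
    next
      case False
      then obtain u where "u \<in> keys p" "lookup u 0 = 0" by blast
      then show ?thesis by (intro exI[of _ 0] exI[of _ p] exI[of _ u]) simp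
    qed
  qed
  moreover obtain w where "w \<in> keys p" using assms by (metis keys_eq_empty ex_in_conv)
  ultimately show ?thesis using that by blast
qed

section \<open>The tensor square\<close>

text \<open>\<open>left\<close> and \<open>right\<close> drop the exponent of the shared scalar v_n,
  while \<open>emb1\<close> and \<open>emb2\<close> keep it. In \<open>mon_tensor_split\<close> it
  therefore reappears once, as a separate factor.\<close>

definition left :: "(nat \<Rightarrow>\<^sub>0 nat) \<Rightarrow> (nat \<Rightarrow>\<^sub>0 nat)" where
  "left w = Abs_poly_mapping (\<lambda>i. if i = 0 then 0 else lookup w (2 * i - 1))"

definition right :: "(nat \<Rightarrow>\<^sub>0 nat) \<Rightarrow> (nat \<Rightarrow>\<^sub>0 nat)" where
  "right w = Abs_poly_mapping (\<lambda>i. if i = 0 then 0 else lookup w (2 * i))"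

definition emb1 :: "(nat \<Rightarrow>\<^sub>0 nat) \<Rightarrow> (nat \<Rightarrow>\<^sub>0 nat)" where
  "emb1 u = Abs_poly_mapping (\<lambda>k. if k = 0 then lookup u 0 else if odd k then lookup u ((k + 1) div 2) else 0)"

definition emb2 :: "(nat \<Rightarrow>\<^sub>0 nat) \<Rightarrow> (nat \<Rightarrow>\<^sub>0 nat)" where
  "emb2 u = Abs_poly_mapping (\<lambda>k. if even k then lookup u (k div 2) else 0)"

lemma lookup_left: "lookup (left w) i = (if i = 0 then 0 else lookup w (2 * i - 1))"
proof -
  have "{i. (if i = 0 then 0 else lookup w (2 * i - 1)) \<noteq> 0} \<subseteq> (\<lambda>k. (k + 1) div 2) ` keys w"
  proof
    fix i assume "i \<in> {i. (if i = 0 then 0 else lookup w (2 * i - 1)) \<noteq> 0}"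
    then have "i \<noteq> 0" "2 * i - 1 \<in> keys w" by (auto simp: in_keys_iff split: if_splits)
    then show "i \<in> (\<lambda>k. (k + 1) div 2) ` keys w" by (intro image_eqI[of _ _ "2 * i - 1"]) auto
  qed
  from finite_subset[OF this] show ?thesis
    unfolding left_def by (subst lookup_Abs_poly_mapping) (simp_all only: finite_insert finite_imageI finite_keys)
qed

lemma lookup_right: "lookup (right w) i = (if i = 0 then 0 else lookup w (2 * i))"
proof -
  have "{i. (if i = 0 then 0 else lookup w (2 * i)) \<noteq> 0} \<subseteq> (\<lambda>k. k div 2) ` keys w"
  proof
    fix i assume "i \<in> {i. (if i = 0 then 0 else lookup w (2 * i)) \<noteq> 0}"
    then have "2 * i \<in> keys w" by (auto simp: in_keys_iff split: if_splits)
    then show "i \<in> (\<lambda>k. k div 2) ` keys w" by (intro image_eqI[of _ _ "2 * i"]) auto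
  qed
  from finite_subset[OF this] show ?thesis
    unfolding right_def by (subst lookup_Abs_poly_mapping) (simp_all only: finite_insert finite_imageI finite_keys)
qed

lemma lookup_emb1:
  "lookup (emb1 u) k = (if k = 0 then lookup u 0 else if odd k then lookup u ((k + 1) div 2) else 0)"
proof -
  have "{k. (if k = 0 then lookup u 0 else if odd k then lookup u ((k + 1) div 2) else 0) \<noteq> 0}
      \<subseteq> insert 0 ((\<lambda>i. 2 * i - 1) ` keys u)"
  proof
    fix k assume "k \<in> {k. (if k = 0 then lookup u 0 else if odd k then lookup u ((k + 1) div 2) else 0) \<noteq> 0}"
    then have "k = 0 \<or> odd k \<and> (k + 1) div 2 \<in> keys u" by (auto simp: in_keys_iff split: if_splits)
    then show "k \<in> insert 0 ((\<lambda>i. 2 * i - 1) ` keys u)"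
      by (auto intro!: image_eqI[of _ _ "(k + 1) div 2"])
  qed
  from finite_subset[OF this] show ?thesis
    unfolding emb1_def by (subst lookup_Abs_poly_mapping) (simp_all only: finite_insert finite_imageI finite_keys)
qed

lemma lookup_emb2: "lookup (emb2 u) k = (if even k then lookup u (k div 2) else 0)"
proof -
  have "{k. (if even k then lookup u (k div 2) else 0) \<noteq> 0} \<subseteq> (\<lambda>i. 2 * i) ` keys u"
    by (auto simp: in_keys_iff split: if_splits)
  from finite_subset[OF this] show ?thesis
    unfolding emb2_def by (subst lookup_Abs_poly_mapping) (simp_all only: finite_insert finite_imageI finite_keys)
qed

lemma left_add: "left (u + w) = left u + left w"
  and right_add: "right (u + w) = right u + right w"
  and emb1_add: "emb1 (u + w) = emb1 u + emb1 w"
  and emb2_add: "emb2 (u + w) = emb2 u + emb2 w"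
  by (rule poly_mapping_eqI; simp add: lookup_add lookup_left lookup_right lookup_emb1 lookup_emb2)+

lemma emb1_single: "i \<ge> 1 \<Longrightarrow> emb1 (single i k) = single (2 * i - 1) k"
  by (rule poly_mapping_eqI) (auto simp: lookup_emb1 lookup_single when_def elim!: oddE)

lemma emb2_single: "i \<ge> 1 \<Longrightarrow> emb2 (single i k) = single (2 * i) k"
  by (rule poly_mapping_eqI) (auto simp: lookup_emb2 lookup_single when_def)

lemma emb_single_0: "emb1 (single 0 k) = single 0 k" "emb2 (single 0 k) = single 0 k"
  by (rule poly_mapping_eqI; auto simp: lookup_emb1 lookup_emb2 lookup_single when_def elim!: oddE)+

lemma emb_0 [simp]: "emb1 0 = 0" "emb2 0 = 0"
  by (rule poly_mapping_eqI; simp add: lookup_emb1 lookup_emb2)+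

lemma iota1_mon: "iota1 (mon u) = mon (emb1 u)"
proof (induct u rule: expo_induct)
  case (add u i)
  then show ?case
    by (cases "i = 0")
      (simp_all add: iota1_def subst_mon_split emb1_add emb1_single emb_single_0 var_eq_mon mon_mult)
qed (simp add: iota1_def)

lemma iota2_mon: "iota2 (mon u) = mon (emb2 u)"
proof (induct u rule: expo_induct)
  case (add u i)
  then show ?case
    by (cases "i = 0")
      (simp_all add: iota2_def subst_mon_split emb2_add emb2_single emb_single_0 var_eq_mon mon_mult)
qed (simp add: iota2_def)

lemma iota1_var0 [simp]: "iota1 (var 0) = var 0" and iota2_var0 [simp]: "iota2 (var 0) = var 0"
  by (simp_all add: iota1_def iota2_def)

lemma iota_add: "iota1 (p + q) = iota1 p + iota1 q" "iota2 (p + q) = iota2 p + iota2 q"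
  by (simp_all add: iota1_def iota2_def subst_add)

lemma iota_mult: "iota1 (p * q) = iota1 p * iota1 q" "iota2 (p * q) = iota2 p * iota2 q"
  by (simp_all add: iota1_def iota2_def subst_mult)

lemma iota_power: "iota1 (p ^ k) = iota1 p ^ k" "iota2 (p ^ k) = iota2 p ^ k"
  by (simp_all add: iota1_def iota2_def subst_power)

lemma iota_0 [simp]: "iota1 0 = 0" "iota2 0 = 0"
  by (simp_all add: iota1_def iota2_def)

lemma iota_1 [simp]: "iota1 1 = 1" "iota2 1 = 1"
  by (simp_all add: iota1_def iota2_def)

lemma mon_tensor_split:
  "mon w = var 0 ^ lookup w 0 * iota1 (mon (left w)) * iota2 (mon (right w))"
proof -
  have "w = single 0 (lookup w 0) + emb1 (left w) + emb2 (right w)"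
    by (rule poly_mapping_eqI)
      (auto simp: lookup_add lookup_emb1 lookup_emb2 lookup_left lookup_right lookup_single when_def
        elim!: oddE evenE)
  then show ?thesis
    by (metis iota1_mon iota2_mon mon_mult var_power)
qed

definition vlin :: "(pol \<Rightarrow> pol) \<Rightarrow> bool" where
  "vlin F \<longleftrightarrow> additive F \<and> (\<forall>p. F (var 0 * p) = var 0 * F p)"

lemma vlin_power: "vlin F \<Longrightarrow> F (var 0 ^ k * p) = var 0 ^ k * F p"
  by (induct k) (simp_all add: vlin_def mult.assoc)

text \<open>The tensor product of \<open>F\<close> and \<open>G\<close> over F_2[v_n], given on
  monomials. It has the expected values on arbitrary pure tensors once both maps are v_n-linear, see
  \<open>tens_apply\<close>.\<close>

definition tens :: "(pol \<Rightarrow> pol) \<Rightarrow> (pol \<Rightarrow> pol) \<Rightarrow> pol \<Rightarrow> pol" where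
  "tens F G = lin (\<lambda>w. var 0 ^ lookup w 0 * iota1 (F (mon (left w))) * iota2 (G (mon (right w))))"

lemma additive_tens [simp]: "additive (tens F G)"
  by (simp add: tens_def)

lemma tens_add: "tens F G (p + q) = tens F G p + tens F G q"
  by (simp add: additiveD)

lemma tens_mon:
  "tens F G (mon w) = var 0 ^ lookup w 0 * iota1 (F (mon (left w))) * iota2 (G (mon (right w)))"
  by (simp add: tens_def)

lemma tens_apply:
  assumes F: "vlin F" and G: "vlin G"
  shows "tens F G (var 0 ^ a * iota1 x * iota2 y) = var 0 ^ a * iota1 (F x) * iota2 (G y)"
proof (induct x rule: pol_induct)
  case zero
  show ?case using F by (simp add: additive_0 vlin_def)
next
  case (add p q)
  then show ?case using F
    by (simp add: vlin_def iota_add tens_add additiveD[of F] distrib_left distrib_right)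
next
  case (mon p)
  show ?case
  proof (induct y rule: pol_induct)
    case zero
    show ?case using G by (simp add: additive_0 vlin_def)
  next
    case (add p q)
    then show ?case using G
      by (simp add: vlin_def iota_add tens_add additiveD[of G] distrib_left distrib_right)
  next
    case (mon q)
    let ?p = "p - single 0 (lookup p 0)" and ?q = "q - single 0 (lookup q 0)"
    define w where "w = single 0 a + emb1 p + emb2 q"
    have "var 0 ^ a * iota1 (mon p) * iota2 (mon q) = mon w"
      by (simp add: var_power iota1_mon iota2_mon mon_mult w_def)
    moreover have "left w = ?p"
      by (rule poly_mapping_eqI)
        (auto simp: w_def lookup_left lookup_add lookup_emb1 lookup_emb2 lookup_minus lookup_single when_def)
    moreover have "right w = ?q"
      by (rule poly_mapping_eqI)
        (auto simp: w_def lookup_right lookup_add lookup_emb1 lookup_emb2 lookup_minus lookup_single when_def)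
    moreover have "lookup w 0 = a + lookup p 0 + lookup q 0"
      by (simp add: w_def lookup_add lookup_emb1 lookup_emb2)
    moreover have "p = single 0 (lookup p 0) + ?p" "q = single 0 (lookup q 0) + ?q"
      by (rule poly_mapping_eqI; auto simp: lookup_add lookup_minus lookup_single when_def)+
    then have "mon p = var 0 ^ lookup p 0 * mon ?p" "mon q = var 0 ^ lookup q 0 * mon ?q"
      by (metis mon_mult var_power)+
    then have "F (mon p) = var 0 ^ lookup p 0 * F (mon ?p)" "G (mon q) = var 0 ^ lookup q 0 * G (mon ?q)"
      by (metis vlin_power F G)+
    ultimately show ?case
      by (simp add: tens_mon iota_mult iota_power power_add algebra_simps)
  qed
qed

lemma tens_v: "vlin F \<Longrightarrow> vlin G \<Longrightarrow> tens F G (var 0 * p) = var 0 * tens F G p"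
proof (induct p rule: pol_induct)
  case (mon u)
  have "var 0 * mon u = var 0 ^ Suc (lookup u 0) * iota1 (mon (left u)) * iota2 (mon (right u))"
    by (subst mon_tensor_split) (simp add: mult.assoc)
  then have "tens F G (var 0 * mon u) =
      var 0 ^ Suc (lookup u 0) * iota1 (F (mon (left u))) * iota2 (G (mon (right u)))"
    using mon by (simp only: tens_apply)
  then show ?case by (simp only: tens_mon power_Suc mult.assoc)
qed (simp_all add: additive_0 distrib_left tens_add)

lemma tens_v_power: "vlin F \<Longrightarrow> vlin G \<Longrightarrow> tens F G (var 0 ^ k * p) = var 0 ^ k * tens F G p"
  by (induct k) (simp_all add: tens_v mult.assoc)

definition tens_ideal :: "pol set \<Rightarrow> pol set" where
  "tens_ideal I = ideal_of (iota1 ` I \<union> iota2 ` I)"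

lemma is_ideal_tens_ideal [simp]: "is_ideal (tens_ideal I)"
  by (simp add: tens_ideal_def)

lemma iota_mem_tens_ideal: "x \<in> I \<Longrightarrow> iota1 x \<in> tens_ideal I" "x \<in> I \<Longrightarrow> iota2 x \<in> tens_ideal I"
  using ideal_of_subset[of "iota1 ` I \<union> iota2 ` I"] by (auto simp: tens_ideal_def)

lemma tens_ideal_mono: "I \<subseteq> J \<Longrightarrow> tens_ideal I \<subseteq> tens_ideal J"
  unfolding tens_ideal_def
  by (rule ideal_of_mono) (use iota_mem_tens_ideal[of _ J] in \<open>auto simp: tens_ideal_def\<close>)

text \<open>A monomial multiple of a generator of \<open>tens_ideal I\<close> is again a pure tensor
  with one factor in \<open>I\<close>. It thus suffices that \<open>C\<close> is closed under
  addition and contains the images of these tensors.\<close>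

lemma tens_ideal_image:
  assumes F: "vlin F" and G: "vlin G" and I: "is_ideal I"
    and C: "0 \<in> C" "\<And>x y. x \<in> C \<Longrightarrow> y \<in> C \<Longrightarrow> x + y \<in> C"
    and l: "\<And>a x y. x \<in> I \<Longrightarrow> var 0 ^ a * iota1 (F x) * iota2 (G y) \<in> C"
    and r: "\<And>a x y. y \<in> I \<Longrightarrow> var 0 ^ a * iota1 (F x) * iota2 (G y) \<in> C"
    and z: "z \<in> tens_ideal I"
  shows "tens F G z \<in> C"
  using z unfolding tens_ideal_def
proof (induct rule: ideal_of_additive_induct)
  case (mult c g)
  show ?case
  proof (induct c rule: pol_induct)
    case (mon w)
    consider x where "x \<in> I" "g = iota1 x" | x where "x \<in> I" "g = iota2 x" using mult by auto
    then show ?case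
    proof cases
      case 1
      have "mon w * g = var 0 ^ lookup w 0 * iota1 (mon (left w) * x) * iota2 (mon (right w))"
        by (subst mon_tensor_split) (simp add: 1 iota_mult mult_ac)
      then show ?thesis using l[OF is_ideal_mult[OF I 1(1)]] by (simp add: tens_apply[OF F G])
    next
      case 2
      have "mon w * g = var 0 ^ lookup w 0 * iota1 (mon (left w)) * iota2 (mon (right w) * x)"
        by (subst mon_tensor_split) (simp add: 2 iota_mult mult_ac)
      then show ?thesis using r[OF is_ideal_mult[OF I 2(1)]] by (simp add: tens_apply[OF F G])
    qed
  qed (auto simp: additive_0 C distrib_right tens_add)
qed (auto simp: additive_0 C tens_add)

section \<open>The coproduct modulo the first variable\<close>

text \<open>The coproduct for which every e_i is primitive. It agrees with \<open>Delta\<close>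
  modulo v_n, but does not depend on n or s and preserves monomial degrees.\<close>

definition delta_img :: "nat \<Rightarrow> pol" where
  "delta_img i = (if i = 0 then var 0 else var (2 * i - 1) + var (2 * i))"

definition delta :: "pol \<Rightarrow> pol" where
  "delta = subst delta_img"

text \<open>The multiplication map from the tensor square back to the ring, on exponents. As
  \<open>delta\<close> merely distributes the factors of a monomial over the two sides, terms coming
  from different monomials have different merges and cannot cancel.\<close>

definition merge :: "(nat \<Rightarrow>\<^sub>0 nat) \<Rightarrow> (nat \<Rightarrow>\<^sub>0 nat)" where
  "merge w = left w + right w + single 0 (lookup w 0)"

lemma merge_add: "merge (u + w) = merge u + merge w"
  by (simp add: merge_def left_add right_add lookup_add single_add algebra_simps)

lemma merge_delta: "w \<in> keys (delta (mon u)) \<Longrightarrow> merge w = u"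
proof (induct u arbitrary: w rule: expo_induct)
  case zero
  then have "w = 0" by (simp add: delta_def)
  then show ?case
    by (intro poly_mapping_eqI) (simp add: merge_def lookup_add lookup_left lookup_right)
next
  case (add u i)
  have "delta (mon (u + single i 1)) = delta (mon u) * delta_img i"
    by (simp add: delta_def subst_mon_split)
  then obtain x y where xy: "w = x + y" "x \<in> keys (delta (mon u))" "y \<in> keys (delta_img i)"
    using add(2) keys_mult[of "delta (mon u)" "delta_img i"] by auto
  have "merge y = single i 1"
  proof (cases "i = 0")
    case True
    then have "y = single 0 1" using xy(3) by (simp add: delta_img_def var_eq_mon)
    then show ?thesis using True
      by (intro poly_mapping_eqI) (auto simp: merge_def lookup_add lookup_left lookup_right lookup_single when_def)
  next
    case False
    then have "y = single (2 * i - 1) 1 \<or> y = single (2 * i) 1"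
      using xy(3) keys_add[of "var (2 * i - 1)" "var (2 * i)"] by (auto simp: delta_img_def var_eq_mon)
    then show ?thesis using False
      by (intro poly_mapping_eqI)
        (auto simp: merge_def lookup_add lookup_left lookup_right lookup_single when_def)
  qed
  then show ?case using add(1)[OF xy(2)] xy(1) by (simp add: merge_add)
qed

text \<open>A case of Lucas' theorem: with N = 2^a + r, only the summand k = 2^a of Vandermonde's
  convolution survives modulo 2.\<close>

lemma odd_choose_power2:
  assumes "2 ^ a \<le> N" "N < 2 ^ Suc a"
  shows "odd (N choose (2 ^ a))"
proof -
  define r where "r = N - 2 ^ a"
  have N: "N = 2 ^ a + r" and r: "r < 2 ^ a" using assms by (auto simp: r_def)
  have ev: "even ((2 ^ a choose k) * (r choose (2 ^ a - k)))" if "k < 2 ^ a" for k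
  proof (cases "k = 0")
    case True
    then show ?thesis using r by (simp add: binomial_eq_0)
  next
    case False
    then obtain k' where k': "k = Suc k'" by (cases k) auto
    have "k * (2 ^ a choose k) = 2 ^ a * ((2 ^ a - 1) choose k')"
      using binomial_absorption[of k' "2 ^ a"] k' by simp
    then have d: "2 ^ a dvd k * (2 ^ a choose k)" by simp
    have "even (2 ^ a choose k)"
    proof (rule ccontr)
      assume "odd (2 ^ a choose k)"
      then have "coprime (2 ^ a) (2 ^ a choose k)" by simp
      then have "2 ^ a dvd k" using d by (simp add: coprime_dvd_mult_left_iff)
      then show False using that False by (simp add: nat_dvd_not_less)
    qed
    then show ?thesis by simp
  qed
  have "N choose (2 ^ a) = (\<Sum>k\<le>2 ^ a. (2 ^ a choose k) * (r choose (2 ^ a - k)))"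
    by (simp add: N vandermonde)
  also have "\<dots> = (\<Sum>k<2 ^ a. (2 ^ a choose k) * (r choose (2 ^ a - k))) + 1"
    by (simp add: lessThan_Suc_atMost[symmetric])
  finally have "N choose (2 ^ a) = (\<Sum>k<2 ^ a. (2 ^ a choose k) * (r choose (2 ^ a - k))) + 1" .
  moreover have "even (\<Sum>k<2 ^ a. (2 ^ a choose k) * (r choose (2 ^ a - k)))"
    by (rule dvd_sum) (use ev in blast)
  ultimately show ?thesis by simp
qed

lemma of_nat_bit_odd: "odd k \<Longrightarrow> of_nat k = (1::bit)"
  by (auto elim!: oddE)

lemma lookup_of_nat_mon: "lookup (of_nat k * mon u) w = (if u = w then of_nat k else (0::bit))"
  by (induct k) (simp_all add: distrib_right lookup_add lookup_mon del: add_bit_eq_xor)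

text \<open>The witness that \<open>e ^ u\<close> is not primitive unless \<open>u\<close> is a power of two of a single variable.\<close>

definition split_expo :: "(nat \<Rightarrow>\<^sub>0 nat) \<Rightarrow> nat \<Rightarrow> nat \<Rightarrow> (nat \<Rightarrow>\<^sub>0 nat)" where
  "split_expo u i a = emb1 (single i (2 ^ a)) + emb2 (u - single i (2 ^ a))"

text \<open>Discarding all terms with a factor e_k tensor 1, \<open>k \<noteq> i\<close>, turns
  \<open>delta\<close> into \<open>tau\<close>, which sends every other generator to the right-hand
  side. What remains is the binomial expansion in e_i, and the coefficient of the top power of two
  in the exponent is odd.\<close>

lemma lookup_delta_split_expo:
  assumes "i \<ge> 1" "2 ^ a \<le> lookup u i" "lookup u i < 2 ^ Suc a"
  shows "lookup (delta (mon u)) (split_expo u i a) = 1"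
proof -
  define J :: "pol set" where "J = {p. \<forall>w\<in>keys p. \<exists>k\<ge>1. k \<noteq> i \<and> lookup w (2 * k - 1) \<noteq> 0}"
  define tau where "tau k = (if k = i then var (2 * i - 1) + var (2 * i) else if k = 0 then var 0 else var (2 * k))" for k
  let ?w = "split_expo u i a" and ?N = "lookup u i" and ?u = "u - single i (lookup u i)"
  have J: "is_ideal J"
    unfolding is_ideal_def
  proof (intro conjI ballI allI)
    show "0 \<in> J" by (simp add: J_def)
    show "x + y \<in> J" if "x \<in> J" "y \<in> J" for x y
      using that keys_add[of x y] unfolding J_def by blast
    show "x * y \<in> J" if "y \<in> J" for x y
    proof -
      have "\<exists>k\<ge>1. k \<noteq> i \<and> lookup w (2 * k - 1) \<noteq> 0" if w: "w \<in> keys (x * y)" for w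
      proof -
        obtain b c where bc: "w = b + c" "c \<in> keys y" using w keys_mult[of x y] by auto
        then obtain k where "k \<ge> 1" "k \<noteq> i" "lookup c (2 * k - 1) \<noteq> 0"
          using \<open>y \<in> J\<close> unfolding J_def by blast
        then show ?thesis using bc by (intro exI[of _ k]) (auto simp: lookup_add)
      qed
      then show ?thesis by (simp add: J_def)
    qed
  qed
  have "delta (mon u) + subst tau (mon u) \<in> J"
    unfolding delta_def
  proof (rule subst_cong_ideal[OF J])
    fix k
    have "var (2 * k - 1) \<in> J" if "k \<ge> 1" "k \<noteq> i"
      using that by (auto simp: J_def var_eq_mon lookup_single)
    then show "delta_img k + tau k \<in> J"
      using assms(1) is_ideal_0[OF J] by (auto simp: delta_img_def tau_def add.assoc)
  qed
  moreover have "lookup ?w (2 * k - 1) = 0" if "k \<ge> 1" "k \<noteq> i" for k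
    using that assms(1)
    by (auto simp: split_expo_def lookup_add lookup_emb1 lookup_emb2 lookup_single when_def)
  ultimately have "?w \<notin> keys (delta (mon u) + subst tau (mon u))"
    unfolding J_def mem_Collect_eq by (metis (no_types, lifting))
  then have "lookup (delta (mon u)) ?w + lookup (subst tau (mon u)) ?w = 0"
    by (simp only: not_in_keys_iff_lookup_eq_zero lookup_add)
  then have eq: "lookup (delta (mon u)) ?w = lookup (subst tau (mon u)) ?w"
    by (metis bit_cases add.right_neutral add_0)
  have u: "u = ?u + single i ?N"
    by (rule poly_mapping_eqI) (auto simp: lookup_add lookup_minus lookup_single when_def)
  have "subst tau (mon ?u) = iota2 (mon ?u)"
    unfolding iota2_def subst_mon expo_eval_def
    by (rule prod.cong) (auto simp: tau_def in_keys_iff lookup_minus lookup_single when_def)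
  then have "subst tau (mon u) = mon (emb2 ?u) * (var (2 * i - 1) + var (2 * i)) ^ ?N"
    using subst_mon_split[of tau ?u i ?N] u by (simp add: iota2_mon tau_def)
  also have "\<dots> = (\<Sum>k\<le>?N. of_nat (?N choose k) * mon (emb2 ?u + single (2 * i - 1) k + single (2 * i) (?N - k)))"
    unfolding binomial_ring sum_distrib_left
    by (rule sum.cong) (simp_all add: var_power mon_mult[symmetric] mult_ac)
  finally have "lookup (subst tau (mon u)) ?w =
     (\<Sum>k\<le>?N. if emb2 ?u + single (2 * i - 1) k + single (2 * i) (?N - k) = ?w then of_nat (?N choose k) else 0)"
    by (simp add: lookup_sum lookup_of_nat_mon)
  also have "\<dots> = (\<Sum>k\<le>?N. if k = 2 ^ a then of_nat (?N choose k) else 0)"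
  proof (rule sum.cong[OF refl])
    fix k assume "k \<in> {..?N}"
    have "lookup (emb2 ?u + single (2 * i - 1) k + single (2 * i) (?N - k)) (2 * i - 1) = k"
      using assms(1) by (auto simp: lookup_add lookup_emb2 lookup_single when_def)
    moreover have "lookup ?w (2 * i - 1) = 2 ^ a"
      using assms(1) by (auto simp: split_expo_def lookup_add lookup_emb1 lookup_emb2 lookup_single when_def)
    moreover have "emb2 ?u + single (2 * i - 1) (2 ^ a) + single (2 * i) (?N - 2 ^ a) = ?w"
      using assms(1)
      by (intro poly_mapping_eqI)
        (auto simp: split_expo_def lookup_add emb1_single lookup_emb2 lookup_minus lookup_single when_def)
    ultimately show "(if emb2 ?u + single (2 * i - 1) k + single (2 * i) (?N - k) = ?w then of_nat (?N choose k) else 0)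
      = (if k = 2 ^ a then of_nat (?N choose k) else (0::bit))"
      by metis
  qed
  also have "\<dots> = of_nat (?N choose 2 ^ a)" using assms by simp
  also have "\<dots> = 1" by (rule of_nat_bit_odd) (rule odd_choose_power2[OF assms(2,3)])
  finally show ?thesis using eq by simp
qed

lemma additive_eq_filt:
  assumes "additive f" "\<And>w. w \<in> keys p \<Longrightarrow> f (mon w) = (if Q w then mon w else 0)"
  shows "f p = filt Q p"
proof -
  have "f p = (\<Sum>w\<in>keys p. f (mon w))"
    by (subst pol_expand) (simp add: additive_sum assms(1))
  also have "\<dots> = (\<Sum>w\<in>keys p. filt Q (mon w))"
    by (rule sum.cong) (simp_all add: assms(2) filt_mon)
  also have "\<dots> = filt Q p"
    by (simp add: additive_sum[OF additive_filt, symmetric] pol_expand[symmetric])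
  finally show ?thesis .
qed

lemma delta_expand: "delta p = (\<Sum>u\<in>keys p. delta (mon u))"
  by (subst pol_expand) (simp add: delta_def additive_sum)

lemma keys_delta: "w \<in> keys (delta p) \<Longrightarrow> merge w \<in> keys p"
proof -
  assume "w \<in> keys (delta p)"
  then have "w \<in> (\<Union>u\<in>keys p. keys (delta (mon u)))"
    using keys_sum[of "\<lambda>u. delta (mon u)" "keys p"] by (auto simp: delta_expand[of p])
  then show ?thesis using merge_delta by auto
qed

lemma lookup_delta_split:
  assumes "u \<in> keys p" "i \<ge> 1" "2 ^ a \<le> lookup u i" "lookup u i < 2 ^ Suc a"
  shows "lookup (delta p) (split_expo u i a) = 1"
proof -
  let ?w = "split_expo u i a"
  have 1: "lookup (delta (mon u)) ?w = 1" by (rule lookup_delta_split_expo[OF assms(2-4)])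
  then have "merge ?w = u" by (intro merge_delta) (simp add: in_keys_iff)
  then have "lookup (delta (mon x)) ?w = 0" if "x \<noteq> u" for x
    using merge_delta[of ?w x] that by (metis in_keys_iff)
  then have "lookup (delta p) ?w = (\<Sum>x\<in>keys p. if x = u then 1 else 0)"
    unfolding delta_expand[of p] lookup_sum using 1 by (intro sum.cong) auto
  then show ?thesis using assms(1) by simp
qed

lemma left_split_expo: "i \<ge> 1 \<Longrightarrow> left (split_expo u i a) = single i (2 ^ a)"
  by (rule poly_mapping_eqI)
    (auto simp: split_expo_def lookup_left lookup_add lookup_emb1 lookup_emb2 lookup_single when_def)

lemma right_split_expo:
  "i \<ge> 1 \<Longrightarrow> lookup u 0 = 0 \<Longrightarrow> right (split_expo u i a) = u - single i (2 ^ a)"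
  by (rule poly_mapping_eqI)
    (auto simp: split_expo_def lookup_right lookup_add lookup_emb1 lookup_emb2 lookup_minus lookup_single when_def)

lemma lookup_split_expo_0: "i \<ge> 1 \<Longrightarrow> lookup (split_expo u i a) 0 = lookup u 0"
  by (auto simp: split_expo_def lookup_add lookup_emb1 lookup_emb2 lookup_minus lookup_single when_def)

lemma mdeg_nonneg: "lookup u 0 = 0 \<Longrightarrow> mdeg n u \<ge> 0"
  unfolding mdeg_eq by (rule sum_nonneg) (auto simp: wt_def)

lemma mdeg_pos: "lookup u 0 = 0 \<Longrightarrow> u \<noteq> 0 \<Longrightarrow> mdeg n u > 0"
proof -
  assume u: "lookup u 0 = 0" "u \<noteq> 0"
  then obtain i where i: "i \<in> keys u" by (metis keys_eq_empty ex_in_conv)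
  moreover have "i \<noteq> 0" using i u by (metis in_keys_iff)
  moreover have "lookup u i > 0" using i by (simp add: in_keys_iff)
  ultimately show ?thesis
    unfolding mdeg_eq using u(1) by (intro sum_pos2[of _ i]) (auto simp: wt_def)
qed

lemma top_power_of_two:
  fixes u :: "nat \<Rightarrow>\<^sub>0 nat"
  assumes "u \<noteq> 0" "lookup u 0 = 0"
  obtains i a where "i \<in> keys u" "i \<ge> 1" "2 ^ a \<le> lookup u i" "lookup u i < 2 ^ Suc a"
proof -
  obtain i where i: "i \<in> keys u" using assms(1) by (metis keys_eq_empty ex_in_conv)
  then have "lookup u i \<ge> 1" by (simp add: in_keys_iff Suc_leI)
  then obtain a where "2 ^ a \<le> lookup u i" "lookup u i < 2 ^ (a + 1)"
    using ex_power_ivl1[of 2 "lookup u i"] by auto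
  moreover have "i \<noteq> 0" using i assms(2) by (metis in_keys_iff)
  ultimately show ?thesis using that[of i a] i by simp
qed

lemma filt_v:
  "(\<And>w. P (w + single 0 1) = P w) \<Longrightarrow> filt P (var 0 * q) = var 0 * filt P q"
  by (induct q rule: pol_induct)
    (auto simp: additive_0 additiveD distrib_left var_eq_mon mon_mult filt_mon add.commute)

section \<open>Bi-ideals modulo the first variable\<close>

text \<open>A homogeneous element of least degree of the bi-ideal that is not accounted for by the
  generators it contains is primitive modulo \<open>v\<^sub>n\<close>. Primitive elements of a given degree
  \<open>d\<close> are spanned by \<open>e\<^sub>d\<close>, so the element is itself a generator.\<close>

lemma biideal_mod_v:
  assumes K: "dbl_closed K" and v: "var 0 \<in> K" and hom: "homogeneous_set n K"
    and cst: "\<And>p. p \<in> K \<Longrightarrow> lookup p 0 = 0"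
    and cop: "\<And>p. p \<in> K \<Longrightarrow> delta p \<in> tens_ideal K"
    and x: "x \<in> K" "u \<in> keys (sred x)" "lookup u 0 = 0"
  shows "\<not> normal {j. j \<ge> 1 \<and> var j \<in> K} u"
proof
  define Z where "Z = {j. j \<ge> 1 \<and> var j \<in> K}"
  assume "normal {j. j \<ge> 1 \<and> var j \<in> K} u"
  then have nu: "normal Z u" by (simp add: Z_def)
  have idK: "is_ideal K" using K by (simp add: dbl_closed_def)
  define good where "good w \<longleftrightarrow> normal Z w \<and> lookup w 0 = 0" for w
  have mem: "filt good (sred p) \<in> K" if "p \<in> K" for p
  proof -
    have "mon w \<in> K" if "w \<in> keys (sred p)" "\<not> good w" for w
    proof (cases "lookup w 0 = 0")
      case True
      then have "\<not> normal Z w" using that(2) by (simp add: good_def)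
      then show ?thesis
        by (rule not_normal_mem[OF K keys_sred[OF that(1)]]) (simp add: Z_def)
    next
      case False
      then show ?thesis using is_ideal_mult_right[OF idK v] by (subst mon_v_factor)
    qed
    then have "filt (\<lambda>w. \<not> good w) (sred p) \<in> K"
      by (subst pol_expand) (auto intro!: is_ideal_sum[OF idK] simp: keys_filt)
    moreover have "sred p \<in> K" using that sred_mem_iff[OF K] by simp
    moreover have "filt good (sred p) + filt (\<lambda>w. \<not> good w) (sred p) = sred p"
      by (rule filt_split[symmetric])
    ultimately show ?thesis
      using is_ideal_add_cancel[OF idK, of "filt good (sred p)" "filt (\<lambda>w. \<not> good w) (sred p)"]
      by simp
  qed
  \<comment> \<open>The exponents not explained by \<open>Z\<close>. They do not involve v_n, so
    their degrees are nonnegative and taking the minimum through \<open>nat\<close> is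
    harmless.\<close>
  define S where "S = {u. \<exists>p\<in>K. u \<in> keys p \<and> (\<forall>w\<in>keys p. good w)}"
  have S: "w \<in> S" if "p \<in> K" "w \<in> keys (sred p)" "good w" for p w
    using that mem[OF that(1)] by (auto simp: S_def keys_filt intro!: bexI[of _ "filt good (sred p)"])
  have "u \<in> S" by (rule S[OF x(1,2)]) (simp add: good_def nu x)
  then obtain u where u: "u \<in> S" and min: "\<And>w. w \<in> S \<Longrightarrow> nat (mdeg n u) \<le> nat (mdeg n w)"
    using ex_has_least_nat[of "\<lambda>w. w \<in> S" u "\<lambda>w. nat (mdeg n w)"] by blast
  define d where "d = mdeg n u"
  obtain p where p: "p \<in> K" "u \<in> keys p" "\<forall>w\<in>keys p. good w" using u by (auto simp: S_def)
  define q where "q = hcomp n d p"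
  have q: "q \<in> K" "u \<in> keys q" "\<And>w. w \<in> keys q \<Longrightarrow> good w \<and> mdeg n w = d"
    using p hom by (auto simp: q_def d_def homogeneous_set_def keys_hcomp)
  \<comment> \<open>The degree with v_n counted as 0. Unlike \<open>mdeg\<close> it is invariant
    under multiplication by v_n, which makes the truncation \<open>F\<close> below
    v_n-linear.\<close>
  define ed where "ed w = mdeg n (w - single 0 (lookup w 0))" for w :: "nat \<Rightarrow>\<^sub>0 nat"
  have ed_v: "ed (w + single 0 1) = ed w" for w
  proof -
    have "(w + single 0 1) - single 0 (lookup (w + single 0 1) 0) = w - single 0 (lookup w 0)"
      by (rule poly_mapping_eqI) (auto simp: lookup_add lookup_minus lookup_single when_def)
    then show ?thesis by (simp add: ed_def)
  qed
  have ed: "ed w = mdeg n w" if "lookup w 0 = 0" for w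
    using that by (simp add: ed_def)
  \<comment> \<open>By minimality of d, \<open>F\<close> maps \<open>K\<close> into the multiples of
    v_n. So modulo v_n the tensor square of \<open>F\<close> kills \<open>delta q\<close>, while it
    retains exactly the terms of \<open>delta q\<close> whose two factors both have degree below
    d.\<close>
  define F where "F p = filt (\<lambda>w. normal Z w \<and> ed w < d) (sred p)" for p
  have F: "vlin F"
    unfolding vlin_def additive_def F_def
    using filt_v[of "\<lambda>w. normal Z w \<and> ed w < d"] normal_add_v[of Z _ 1] ed_v
    by (simp add: sred_add sred_mult sred_var0 additiveD)
  have FK: "\<exists>q. F p = var 0 * q" if "p \<in> K" for p
  proof (rule v_dvdI, rule notI)
    fix w assume w: "w \<in> keys (F p)" "lookup w 0 = 0"
    then have "w \<in> S" by (intro S[OF that]) (auto simp: F_def keys_filt good_def)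
    then have "nat d \<le> nat (mdeg n w)" using min d_def by simp
    then show False using w mdeg_nonneg[of w n] ed[of w] by (auto simp: F_def keys_filt)
  qed
  define C :: "pol set" where "C = {z. \<exists>q. z = var 0 * q}"
  have C: "0 \<in> C" "\<And>x y. x \<in> C \<Longrightarrow> y \<in> C \<Longrightarrow> x + y \<in> C"
    unfolding C_def by (auto intro: exI[of _ 0] simp: distrib_left[symmetric])
  have l: "var 0 ^ a * iota1 (F x) * iota2 (F y) \<in> C" if x: "x \<in> K" for a x y
  proof -
    obtain q where "F x = var 0 * q" using FK[OF x] by blast
    then have "var 0 ^ a * iota1 (F x) * iota2 (F y) = var 0 * (var 0 ^ a * iota1 q * iota2 (F y))"
      by (simp add: iota_mult mult_ac)
    then show ?thesis by (auto simp: C_def)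
  qed
  have r: "var 0 ^ a * iota1 (F x) * iota2 (F y) \<in> C" if y: "y \<in> K" for a x y
  proof -
    obtain q where "F y = var 0 * q" using FK[OF y] by blast
    then have "var 0 ^ a * iota1 (F x) * iota2 (F y) = var 0 * (var 0 ^ a * iota1 (F x) * iota2 q)"
      by (simp add: iota_mult mult_ac)
    then show ?thesis by (auto simp: C_def)
  qed
  have tC: "tens F F (delta q) \<in> C"
    by (rule tens_ideal_image[OF F F idK C l r cop[OF q(1)]])
  have tens_eq: "tens F F (delta q) = filt (\<lambda>w. mdeg n (left w) < d \<and> mdeg n (right w) < d) (delta q)"
  proof (rule additive_eq_filt[OF additive_tens])
    fix w assume "w \<in> keys (delta q)"
    then have g: "good (merge w)" using keys_delta q(3) by blast
    then have w0: "lookup w 0 = 0" by (simp add: good_def merge_def lookup_add)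
    have n: "normal Z (left w)" "normal Z (right w)"
      using g by (auto simp: good_def merge_def dest!: normal_addD)
    have F_mon: "F (mon x) = (if mdeg n x < d then mon x else 0)" if "normal Z x" "lookup x 0 = 0" for x
      using that sred_mon_id[of x] by (simp add: F_def normal_def filt_mon ed)
    have "F (mon (left w)) = (if mdeg n (left w) < d then mon (left w) else 0)"
      "F (mon (right w)) = (if mdeg n (right w) < d then mon (right w) else 0)"
      by (rule F_mon; simp add: n lookup_left lookup_right)+
    moreover have "mon w = iota1 (mon (left w)) * iota2 (mon (right w))"
      using mon_tensor_split[of w] w0 by simp
    ultimately show "tens F F (mon w)
        = (if mdeg n (left w) < d \<and> mdeg n (right w) < d then mon w else 0)"
      using w0 unfolding tens_mon by simp
  qed
  have prim: "\<exists>i a. odd i \<and> w = single i (2 ^ a)" if w: "w \<in> keys q" for w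
  proof -
    have g: "good w" "mdeg n w = d" using q(3)[OF w] by auto
    have w0: "lookup w 0 = 0" using g by (simp add: good_def)
    have "w \<noteq> 0" using cst[OF q(1)] w by (auto simp: in_keys_iff)
    then obtain i a where ia: "i \<in> keys w" "i \<ge> 1" "2 ^ a \<le> lookup w i" "lookup w i < 2 ^ Suc a"
      using top_power_of_two[OF _ w0] by blast
    \<comment> \<open>Otherwise \<open>split_expo\<close> cuts w into two factors of positive
      degree. Both then have degree below d, so this term survives the truncation.\<close>
    have "w = single i (2 ^ a)"
    proof (rule ccontr)
      assume ne: "w \<noteq> single i (2 ^ a)"
      let ?w = "split_expo w i a" and ?r = "w - single i (2 ^ a)"
      have wr: "w = single i (2 ^ a) + ?r"
        by (rule poly_mapping_eqI)
          (use ia(3) in \<open>auto simp: lookup_add lookup_minus lookup_single when_def\<close>)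
      have "?r \<noteq> 0" using ne wr by (metis add.right_neutral)
      moreover have "lookup ?r 0 = 0" using w0 by (simp add: lookup_minus)
      ultimately have "mdeg n ?r > 0" by (intro mdeg_pos)
      moreover have "mdeg n (single i (2 ^ a)) > 0" using ia(2) by (simp add: mdeg_var)
      moreover have "mdeg n (single i (2 ^ a)) + mdeg n ?r = d" using wr mdeg_add g(2) by metis
      ultimately have "lookup (tens F F (delta q)) ?w = 1"
        using lookup_delta_split[OF w ia(2-4)]
        by (simp add: tens_eq lookup_filt left_split_expo[OF ia(2)] right_split_expo[OF ia(2) w0])
      moreover have "lookup (tens F F (delta q)) ?w = 0"
        using tC lookup_v_mult_0[of ?w] lookup_split_expo_0[OF ia(2), of w a] w0
        by (auto simp: C_def)
      ultimately show False by simp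
    qed
    moreover have "odd i" using g(1) ia(1,2) by (auto simp: good_def normal_def odd_expo_def)
    ultimately show ?thesis by blast
  qed
  obtain i a where ia: "odd i" "u = single i (2 ^ a)" using prim[OF q(2)] by blast
  have i1: "i \<ge> 1" using ia(1) by (cases i) auto
  \<comment> \<open>The degree i * 2^a determines the odd number i and a, so only one monomial of
    this shape has degree d.\<close>
  have "w = u" if w: "w \<in> keys q" for w
  proof -
    obtain i' a' where ia': "odd i'" "w = single i' (2 ^ a')" using prim[OF w] by blast
    have "i' \<ge> 1" using ia'(1) by (cases i') auto
    then have "int (i' * 2 ^ a') = int (i * 2 ^ a)"
      using q(3)[OF w] q(3)[OF q(2)] i1 ia ia' by (simp add: mdeg_var)
    then have "i' * 2 ^ a' = i * 2 ^ a" by (simp only: of_nat_eq_iff)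
    from odd_pow_mult_eq[OF ia'(1) ia(1) this] show ?thesis using ia ia' by simp
  qed
  then have kq: "keys q = {u}" using q(2) by blast
  have "q = (\<Sum>w\<in>keys q. mon w)" by (rule pol_expand)
  also have "\<dots> = mon u" by (simp add: kq)
  finally have "q = mon u" .
  then have "var i ^ (2 ^ a) \<in> K" using q(1) ia by (simp add: var_power)
  then have "i * 2 ^ a \<in> Z" using dbl_closed_var_iff[OF K i1] i1 by (simp add: Z_def)
  then have "lookup u i < 2 ^ a" using q(3)[OF q(2)] ia(1) by (auto simp: good_def normal_def)
  then show False using ia by simp
qed

section \<open>The relations and the coproduct of \<open>CK(n)(SO\<^sub>m)\<close>\<close>

declare delta_e.simps [simp del]

lemma is_ideal_JR [simp]: "is_ideal (JR n s)"
  by (simp add: JR_def)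

lemma rels_JR: "g \<in> rels n s \<Longrightarrow> g \<in> JR n s"
  using ideal_of_subset by (auto simp: JR_def)

lemma var_mem_JR: "j > s \<Longrightarrow> var j \<in> JR n s"
  by (rule rels_JR) (auto simp: rels_def)

lemma v_var_mem_JR: "2 ^ n \<le> j \<Longrightarrow> var 0 * var j \<in> JR n s"
proof (cases "j \<le> s")
  case True
  assume "2 ^ n \<le> j"
  with True show ?thesis by (intro rels_JR) (auto simp: rels_def)
next
  case False
  then show ?thesis by (intro is_ideal_mult[OF is_ideal_JR] var_mem_JR) simp
qed

lemma square_mem_JR:
  assumes "i \<ge> 1"
  shows "var i ^ 2 + var (2 * i) \<in> JR n s"
proof (cases "i \<le> s")
  case True
  then have "var i ^ 2 - eR s (2 * i) \<in> JR n s"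
    using assms by (intro rels_JR) (auto simp: rels_def)
  then have 1: "var i ^ 2 + eR s (2 * i) \<in> JR n s" by simp
  have 2: "eR s (2 * i) + var (2 * i) \<in> JR n s"
    using assms by (simp add: eR_def is_ideal_0 var_mem_JR)
  from is_ideal_add[OF is_ideal_JR 1 2] show ?thesis by (simp add: add.assoc)
next
  case False
  then show ?thesis
    by (simp add: power2_eq_square is_ideal_add[OF is_ideal_JR] is_ideal_mult[OF is_ideal_JR] var_mem_JR)
qed

lemma dbl_closed_JR: "is_ideal J \<Longrightarrow> JR n s \<subseteq> J \<Longrightarrow> dbl_closed J"
  using square_mem_JR by (auto simp: dbl_closed_def)

lemma hcomp_rels: "g \<in> rels n s \<Longrightarrow> hcomp n d g = g \<or> hcomp n d g = 0"
proof -
  assume "g \<in> rels n s"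
  then consider i where "i \<ge> 1" "g = var i ^ 2 + eR s (2 * i)" | j where "g = var j"
    | i where "g = var 0 * var i"
    by (fastforce simp: rels_def)
  then show ?thesis
  proof cases
    case 1
    then have "mdeg n (single i 2) = mdeg n (single (2 * i) 1)" by (simp add: mdeg_var)
    then show ?thesis
      unfolding 1(2) var_power eR_def var_eq_mon[of "2 * i"] by (auto simp: hcomp_add hcomp_mon)
  qed (auto simp: hcomp_mon var_eq_mon mon_mult)
qed

lemma is_ideal_no_const: "is_ideal {p::pol. lookup p 0 = 0}"
proof -
  have "lookup (r * p) 0 = 0" if "lookup p 0 = (0::bit)" for r p :: pol
  proof (rule ccontr)
    assume "lookup (r * p) 0 \<noteq> 0"
    then have "0 \<in> keys (r * p)" by (simp only: in_keys_iff not_False_eq_True)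
    then obtain a b where ab: "0 = a + b" "b \<in> keys p" using keys_mult[of r p] by auto
    have "lookup b i = 0" for i using ab(1) by (metis add_is_0 lookup_add lookup_zero)
    then have "b = 0" by (intro poly_mapping_eqI) simp
    then show False using ab(2) that by (metis in_keys_iff)
  qed
  then show ?thesis by (simp add: is_ideal_def lookup_add)
qed

lemma var_no_const: "lookup (var i) 0 = 0"
proof -
  have "lookup (single i (1::nat)) i \<noteq> lookup 0 i" by simp
  then have "single i (1::nat) \<noteq> 0" by metis
  then show ?thesis by (simp add: var_eq_mon lookup_mon)
qed

lemma rels_no_const: "g \<in> rels n s \<Longrightarrow> lookup g 0 = 0"
proof -
  assume g: "g \<in> rels n s"
  have "var i * q \<in> {p. lookup p 0 = 0}" for i q
    by (rule is_ideal_mult_right[OF is_ideal_no_const]) (simp add: var_no_const)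
  then show ?thesis using g
    by (auto simp: rels_def eR_def power2_eq_square lookup_add var_no_const)
qed

lemma JR_no_const: "p \<in> JR n s \<Longrightarrow> lookup p 0 = 0"
  using ideal_of_least[OF is_ideal_no_const, of "rels n s"] rels_no_const by (auto simp: JR_def)

lemma iota_var: "i \<ge> 1 \<Longrightarrow> iota1 (var i) = var (2 * i - 1)" "i \<ge> 1 \<Longrightarrow> iota2 (var i) = var (2 * i)"
  by (simp_all add: iota1_def iota2_def)

lemma delta_add: "delta (p + q) = delta p + delta q"
  and delta_mult: "delta (p * q) = delta p * delta q"
  and delta_power: "delta (p ^ k) = delta p ^ k"
  and delta_var0 [simp]: "delta (var 0) = var 0"
  by (simp_all add: delta_def subst_add subst_mult subst_power delta_img_def)

lemma delta_var: "i \<ge> 1 \<Longrightarrow> delta (var i) = iota1 (var i) + iota2 (var i)"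
  by (simp add: delta_def delta_img_def iota_var)

text \<open>Squaring is additive and v_n is a scalar. The point is that \<open>I0\<close> also
  contains the relations of H_0, which the coproduct condition on I does not cover.\<close>

lemma delta_rels:
  assumes "g \<in> rels n s"
  shows "delta g = iota1 g + iota2 g"
proof -
  have e: "delta (eR s j) = iota1 (eR s j) + iota2 (eR s j)" for j
    by (simp add: eR_def delta_var) (simp add: delta_def)
  consider i where "i \<ge> 1" "g = var i ^ 2 + eR s (2 * i)" | j where "j \<ge> 1" "g = var j"
    | i where "i \<ge> 1" "g = var 0 * var i"
    using assms unfolding rels_def
  proof (elim UnE CollectE exE conjE)
    fix i assume "2 ^ n \<le> i" "g = var 0 * var i"
    moreover have "(1::nat) \<le> 2 ^ n" by simp
    ultimately show thesis using that(3) order_trans by blast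
  next
    fix j assume "s < j" "g = var j"
    then show thesis using that(2)[of j] by simp
  next
    fix i assume "1 \<le> i" "g = var i ^ 2 - eR s (2 * i)"
    then show thesis using that(1)[of i] by simp
  qed
  then show ?thesis
    by cases (simp_all only: delta_add e delta_power delta_var delta_mult delta_var0 iota1_var0 iota2_var0
        iota_add iota_mult iota_power square_add distrib_left add_ac)
qed

text \<open>The summand a = 0 is the diagonal term. For a \<ge> 1 the product contains the factor
  with b = 0; keeping this factor visible shows that the whole expression vanishes together with
  e_t.\<close>

lemma dtilde_odd_form:
  assumes "i < 2 ^ n - 1"
  defines "t \<equiv> angle n ((2 ^ n - 1 - i) div 2)"
  shows "\<exists>E. dtilde_odd n s i = var 0 * eL s t * eRt s t + var 0 ^ 2 * (eL s t + eRt s t) * E"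
proof -
  define k where "k = (2 ^ n - 1 - i) div 2"
  define f where "f a = var 0 ^ (a + 1) * eL s (angle n (k div 2 ^ a)) * eRt s (angle n (k div 2 ^ a)) *
      (\<Prod>b\<in>{..<a}. eL s (angle n (k div 2 ^ b)) + eRt s (angle n (k div 2 ^ b)))" for a
  have "dtilde_odd n s i = (\<Sum>a\<in>{0..multiplicity 2 k}. f a)"
    using assms(1) by (simp add: dtilde_odd_def f_def k_def Let_def)
  also have "\<dots> = f 0 + (\<Sum>a\<in>{0<..multiplicity 2 k}. f a)"
    by (rule sum.head) simp
  also have "f 0 = var 0 * eL s t * eRt s t" by (simp add: f_def t_def k_def)
  finally have 1: "dtilde_odd n s i = var 0 * eL s t * eRt s t + (\<Sum>a\<in>{0<..multiplicity 2 k}. f a)" .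
  have "var 0 ^ 2 * (eL s t + eRt s t) dvd (\<Sum>a\<in>{0<..multiplicity 2 k}. f a)"
  proof (rule dvd_sum)
    fix a assume "a \<in> {0<..multiplicity 2 k}"
    then have a: "a \<ge> 1" by simp
    have "eL s t + eRt s t = (\<lambda>b. eL s (angle n (k div 2 ^ b)) + eRt s (angle n (k div 2 ^ b))) 0"
      by (simp add: t_def k_def)
    also have "\<dots> dvd (\<Prod>b\<in>{..<a}. eL s (angle n (k div 2 ^ b)) + eRt s (angle n (k div 2 ^ b)))"
      by (rule dvd_prodI) (use a in auto)
    finally have "eL s t + eRt s t dvd \<dots>" .
    moreover have "var 0 ^ 2 dvd var 0 ^ (a + 1)" using a by (intro le_imp_power_dvd) simp
    ultimately show "var 0 ^ 2 * (eL s t + eRt s t) dvd f a"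
      unfolding f_def by (intro mult_dvd_mono dvd_mult2)
  qed
  then show ?thesis using 1 by (auto elim!: dvdE)
qed

lemma v_dvd_dtilde_odd: "\<exists>E. dtilde_odd n s i = var 0 * E"
proof (cases "i < 2 ^ n - 1")
  case True
  then obtain x y z where "dtilde_odd n s i = var 0 * x * y + var 0 ^ 2 * (x + y) * z"
    using dtilde_odd_form by blast
  then show ?thesis
    by (intro exI[of _ "x * y + var 0 * (x + y) * z"]) (simp add: power2_eq_square algebra_simps)
next
  case False
  then show ?thesis
    by (cases "i = 2 ^ n - 1") (auto simp: dtilde_odd_def mult.assoc intro: exI[of _ 0])
qed

text \<open>The correction terms of odd generators are multiples of v_n, Frobenius passes the
  congruence from h to 2h, and above s the generator itself lies in \<open>K\<close>.\<close>

lemma delta_cong_Delta: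
  assumes K: "is_ideal K" "var 0 \<in> K" "JR n s \<subseteq> K"
  shows "delta p + Delta n s p \<in> tens_ideal K"
  unfolding delta_def Delta_def
proof (rule subst_cong_ideal[OF is_ideal_tens_ideal])
  fix i
  let ?T = "tens_ideal K"
  note add = is_ideal_add[OF is_ideal_tens_ideal] and mult = is_ideal_mult_right[OF is_ideal_tens_ideal]
  have "var 0 \<in> ?T" using iota_mem_tens_ideal(1)[OF K(2)] by simp
  then have v: "var 0 * q \<in> ?T" for q by (rule mult)
  have "delta_img i + delta_e n s i \<in> ?T" if "i \<ge> 1"
    using that
  proof (induct i rule: less_induct)
    case (less i)
    have D: "delta_img i = iota1 (var i) + iota2 (var i)"
      using less by (simp add: delta_img_def iota_var)
    show ?case
    proof (cases "i > s")
      case True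
      then have "var i \<in> K" using var_mem_JR K(3) by blast
      then have "delta_img i \<in> ?T" unfolding D by (intro add iota_mem_tens_ideal)
      then show ?thesis using True by (subst delta_e.simps) simp
    next
      case le: False
      show ?thesis
      proof (cases "even i")
        case True
        then obtain h where h: "i = 2 * h" by blast
        then have h1: "h \<ge> 1" using less(2) by simp
        have e: "delta_e n s i = delta_e n s h ^ 2"
          using le less(2) h by (subst delta_e.simps) simp
        have "(delta_img h + delta_e n s h)\<^sup>2 \<in> ?T"
          using less(1)[of h] h h1 unfolding power2_eq_square by (intro mult) simp
        moreover have "iota1 (var h ^ 2 + var (2 * h)) + iota2 (var h ^ 2 + var (2 * h)) \<in> ?T"
          using square_mem_JR[OF h1, of n s] K(3) by (intro add iota_mem_tens_ideal) auto
        ultimately have "(delta_img h + delta_e n s h)\<^sup>2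
            + (iota1 (var h ^ 2 + var (2 * h)) + iota2 (var h ^ 2 + var (2 * h))) \<in> ?T"
          by (rule add)
        also have "(delta_img h + delta_e n s h)\<^sup>2
            + (iota1 (var h ^ 2 + var (2 * h)) + iota2 (var h ^ 2 + var (2 * h)))
            = delta_img i + delta_e n s i"
          unfolding e unfolding h using h1 by (simp add: delta_img_def iota_add iota_power iota_var square_add add_ac)
        finally show ?thesis .
      next
        case False
        obtain E where "dtilde_odd n s i = var 0 * E" using v_dvd_dtilde_odd by blast
        then have "delta_img i + delta_e n s i = var 0 * E"
          using le less(2) False
          by (subst delta_e.simps) (simp add: delta_img_def eL_def eRt_def add_ac)
        then show ?thesis using v by simp
      qed
    qed
  qed
  then show "delta_img i + (if i = 0 then var 0 else delta_e n s i) \<in> ?T"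
    by (cases "i = 0") (simp_all add: delta_img_def is_ideal_0)
qed

lemma delta_e_odd_power:
  "odd i \<Longrightarrow> i * 2 ^ a \<le> s \<Longrightarrow> delta_e n s (i * 2 ^ a) = (eL s i + eRt s i + dtilde_odd n s i) ^ (2 ^ a)"
proof (induct a)
  case 0
  then show ?case by (subst delta_e.simps) (auto elim!: oddE)
next
  case (Suc a)
  have i: "i \<noteq> 0" using Suc(2) by (cases i) auto
  have "delta_e n s (i * 2 ^ Suc a) = (delta_e n s (i * 2 ^ a)) ^ 2"
    using i Suc(3) by (subst delta_e.simps) (simp add: mult.left_commute)
  also have "\<dots> = ((eL s i + eRt s i + dtilde_odd n s i) ^ (2 ^ a)) ^ 2"
    using Suc by (simp add: mult.left_commute)
  finally show ?case by (simp add: power_mult[symmetric] mult.commute)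
qed

text \<open>So H_0 omits exactly the generators of index at least 2^n, those that v_n kills.\<close>

lemma s_of_m0_of: "s_of (m0_of n m) = min (s_of m) (2 ^ n - 1)"
proof -
  have p: "(2::nat) ^ (n + 1) = 2 * 2 ^ n" "(2::nat) ^ n \<ge> 1" by simp_all
  show ?thesis
    unfolding s_of_def m0_of_def p(1) using p(2) by (auto simp: min_def)
qed

section \<open>Normal forms\<close>

text \<open>Indices above s do not occur, an odd index i has exponent below 2^s because i * 2^s > s,
  and v_n contributes nothing positive. The crude bound ends the recursion in
  \<open>normal_form_exists\<close>.\<close>

lemma mdeg_normal_le:
  assumes Z: "{j. j > s} \<subseteq> Z" and u: "normal Z u"
  shows "mdeg n u \<le> (int s + 1) * (int s * 2 ^ s)"
proof -
  have sub: "keys u \<subseteq> {0..s}"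
  proof
    fix i assume i: "i \<in> keys u"
    then have pos: "lookup u i > 0" by (simp add: in_keys_iff)
    have "\<not> i > s"
    proof
      assume "i > s"
      then have "odd i" "i * 2 ^ 0 \<in> Z" using i u Z by (auto simp: normal_def odd_expo_def)
      then have "lookup u i < 2 ^ 0" using u unfolding normal_def by blast
      then show False using pos by simp
    qed
    then show "i \<in> {0..s}" by simp
  qed
  have "mdeg n u = (\<Sum>i\<in>{0..s}. wt n i * int (lookup u i))"
    by (rule mdeg_superset) (use sub in auto)
  also have "\<dots> \<le> (\<Sum>i\<in>{0..s}. int s * 2 ^ s)"
  proof (rule sum_mono)
    fix i assume i: "i \<in> {0..s}"
    consider "i = 0" | "lookup u i = 0" | "odd i" "i > 0"
      using u unfolding normal_def odd_expo_def by (metis in_keys_iff neq0_conv)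
    then show "wt n i * int (lookup u i) \<le> int s * 2 ^ s"
    proof cases
      case 1
      have "wt n i * int (lookup u i) \<le> 0"
        using 1 by (intro mult_nonpos_nonneg) (simp_all add: wt_def)
      also have "0 \<le> int s * 2 ^ s" by simp
      finally show ?thesis .
    next
      case 3
      have "s < 2 ^ s" by simp
      also have "2 ^ s \<le> i * 2 ^ s" using 3 by simp
      finally have "i * 2 ^ s \<in> Z" using Z by blast
      then have "lookup u i < 2 ^ s" using u 3 unfolding normal_def by blast
      then have "int (lookup u i) \<le> 2 ^ s"
        by (metis less_imp_le of_nat_le_iff of_nat_numeral of_nat_power)
      then show ?thesis using i 3 by (auto simp: wt_def intro!: mult_mono)
    qed simp
  qed
  finally show ?thesis by (simp add: add.commute)
qed

text \<open>A monomial that is not normal contains some e_j with \<open>j \<in> Z\<close> (as a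
  power of an odd generator), which is rewritten as v_n y. With v_n set aside, the new monomials
  have degree larger by 2^n - 1 > 0. Degrees cannot grow forever, since beyond the bound
  \<open>D\<close> every monomial lies in \<open>J\<close>.\<close>

lemma normal_form_exists:
  assumes n: "n \<ge> 1" and J: "is_ideal J" "JR n s \<subseteq> J" and Z: "{j. j > s} \<subseteq> Z"
    and red: "\<And>j. j \<in> Z \<Longrightarrow> \<exists>y. (\<forall>u\<in>keys y. mdeg n u = int j + 2 ^ n - 1) \<and> var j + var 0 * y \<in> J"
  shows "\<exists>p. (\<forall>u\<in>keys p. normal Z u) \<and> x + p \<in> J"
proof -
  define M where "M x \<longleftrightarrow> (\<exists>p. (\<forall>u\<in>keys p. normal Z u) \<and> x + p \<in> J)" for x
  define D where "D = (int s + 1) * (int s * 2 ^ s)"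
  have dbl: "dbl_closed J" by (rule dbl_closed_JR[OF J])
  have MJ: "M x" if "x \<in> J" for x
    unfolding M_def using that by (intro exI[of _ 0]) simp
  have M_add: "M (x + y)" if "M x" "M y" for x y
  proof -
    obtain p q where pq: "\<forall>u\<in>keys p. normal Z u" "x + p \<in> J" "\<forall>u\<in>keys q. normal Z u" "y + q \<in> J"
      using \<open>M x\<close> \<open>M y\<close> unfolding M_def by blast
    have "(x + p) + (y + q) \<in> J" using is_ideal_add[OF J(1) pq(2,4)] .
    then have "(x + y) + (p + q) \<in> J" by (simp add: add_ac)
    moreover have "\<forall>u\<in>keys (p + q). normal Z u" using pq keys_add[of p q] by blast
    ultimately show ?thesis unfolding M_def by blast
  qed
  have M_sum: "M (\<Sum>i\<in>A. f i)" if "\<And>i. i \<in> A \<Longrightarrow> M (f i)" for A and f :: "(nat \<Rightarrow>\<^sub>0 nat) \<Rightarrow> pol"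
    using that by (induct A rule: infinite_finite_induct) (auto intro: M_add MJ is_ideal_0[OF J(1)])
  have M_v: "M (var 0 * x)" if Mx: "M x" for x
  proof -
    obtain p where p: "\<forall>u\<in>keys p. normal Z u" "x + p \<in> J" using Mx unfolding M_def by blast
    have "normal Z u" if uk: "u \<in> keys (var 0 * p)" for u
    proof -
      obtain w where "w \<in> keys p" "u = single 0 1 + w"
        using uk keys_mult[of "var 0" p] by (auto simp: var_eq_mon)
      then show ?thesis using p(1) normal_add_v[of Z w 1] by (simp add: add.commute)
    qed
    moreover have "var 0 * x + var 0 * p \<in> J" using is_ideal_mult[OF J(1) p(2)] by (simp add: distrib_left)
    ultimately show ?thesis unfolding M_def by blast
  qed
  have M_cong: "M x" if "M y" "x + y \<in> J" for x y
  proof -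
    have "M (y + (x + y))" by (rule M_add[OF that(1) MJ[OF that(2)]])
    then show ?thesis by (simp add: add_ac)
  qed
  have "M (mon u)" for u
  proof (induct "nat (D + 1 - mdeg n u)" arbitrary: u rule: less_induct)
    case less
    have p2: "(2::int) ^ n \<ge> 2" using n by (metis power_increasing one_le_numeral power_one_right)
    obtain w where w: "sred (mon u) = mon w" "odd_expo w" "mdeg n w = mdeg n u"
      using sred_mon[of u n] by blast
    have "M (mon w)"
    proof (cases "mdeg n w > D")
      case True
      then have "\<not> normal {j. j > s} w"
        using mdeg_normal_le[of s "{j. j > s}" w n] by (auto simp: D_def)
      then show ?thesis
        using not_normal_mem[OF dbl w(2), of "{j. j > s}"] var_mem_JR J(2) by (intro MJ) blast
    next
      case le: False
      \<comment> \<open>The degree gained by removing one v_n, whether the monomial contained it or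
        the rewriting of e_j produced it.\<close>
      have IH: "M (mon x)" if "mdeg n x = mdeg n w + 2 ^ n - 1" for x
        using that le w(3) p2 by (intro less) auto
      show ?thesis
      proof (cases "lookup w 0 = 0")
        case False
        have "w = (w - single 0 1) + single 0 1"
          using False by (intro poly_mapping_eqI) (auto simp: lookup_add lookup_minus lookup_single when_def)
        then have "mdeg n w = mdeg n (w - single 0 1) + mdeg n (single 0 1)" by (metis mdeg_add)
        then have "mdeg n (w - single 0 1) = mdeg n w + 2 ^ n - 1" by (simp add: mdeg_single wt_def)
        then show ?thesis using M_v[OF IH] mon_v_factor[OF False] by simp
      next
        case w0: True
        show ?thesis
        proof (cases "normal Z w")
          case True
          then show ?thesis
            unfolding M_def by (intro exI[of _ "mon w"]) (simp add: is_ideal_0[OF J(1)])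
        next
          case False
          then obtain i a where ia: "odd i" "i * 2 ^ a \<in> Z" "2 ^ a \<le> lookup w i"
            using w(2) by (auto simp: normal_def not_less)
          then have i1: "i \<ge> 1" by (cases i) auto
          obtain y where y: "\<forall>u\<in>keys y. mdeg n u = int (i * 2 ^ a) + 2 ^ n - 1"
            "var (i * 2 ^ a) + var 0 * y \<in> J" using red[OF ia(2)] by blast
          define w' where "w' = w - single i (2 ^ a)"
          have ww: "w = w' + single i (2 ^ a)"
            by (rule poly_mapping_eqI)
              (use ia(3) in \<open>auto simp: w'_def lookup_add lookup_minus lookup_single when_def\<close>)
          have "mdeg n w = mdeg n w' + int (i * 2 ^ a)"
            using i1 by (simp add: ww mdeg_add mdeg_var)
          then have "M (mon (w' + x))" if "x \<in> keys y" for x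
            using that y(1) by (intro IH) (simp add: mdeg_add)
          then have "M (\<Sum>x\<in>keys y. mon (w' + x))" by (rule M_sum)
          also have "(\<Sum>x\<in>keys y. mon (w' + x)) = mon w' * y"
            by (subst (2) pol_expand) (simp add: sum_distrib_left mon_mult)
          finally have "M (var 0 * (mon w' * y))" by (rule M_v)
          moreover have "mon w + var 0 * (mon w' * y) \<in> J"
          proof -
            have "mon w' * ((var i ^ (2 ^ a) + var (i * 2 ^ a)) + (var (i * 2 ^ a) + var 0 * y)) \<in> J"
              by (intro is_ideal_mult[OF J(1)] is_ideal_add[OF J(1)] dbl_closed_power[OF dbl i1] y(2))
            moreover have "mon w = mon w' * var i ^ (2 ^ a)" by (simp add: ww mon_mult var_power)
            ultimately show ?thesis by (simp add: algebra_simps)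
          qed
          ultimately show ?thesis by (rule M_cong)
        qed
      qed
    qed
    moreover have "mon u + mon w \<in> J" using sred_cong[OF dbl, of "mon u"] w(1) by simp
    ultimately show ?case by (rule M_cong)
  qed
  then have "M (\<Sum>u\<in>keys x. mon u)" by (rule M_sum)
  then show ?thesis unfolding M_def by (simp add: pol_expand[symmetric])
qed

section \<open>Saturated bi-ideals\<close>

lemma homogeneous_JR: "homogeneous_set n (JR n s)"
  unfolding JR_def
proof (rule homogeneous_ideal_of)
  fix g d assume g: "g \<in> rels n s"
  then have "g \<in> ideal_of (rels n s)" using ideal_of_subset by blast
  then show "hcomp n d g \<in> ideal_of (rels n s)"
    using hcomp_rels[OF g, of d] is_ideal_0[OF is_ideal_ideal_of] by auto
qed

lemma homogeneous_insert_v: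
  assumes "homogeneous_set n J"
  shows "homogeneous_set n (ideal_of (J \<union> {var 0}))"
proof (rule homogeneous_ideal_of)
  fix g d assume g: "g \<in> J \<union> {var 0}"
  have "hcomp n d g \<in> J \<union> {0, var 0}"
    using g assms by (auto simp: homogeneous_set_def var_eq_mon hcomp_mon)
  then show "hcomp n d g \<in> ideal_of (J \<union> {var 0})"
    using ideal_of_subset[of "J \<union> {var 0}"] is_ideal_0[OF is_ideal_ideal_of] by auto
qed

lemma keys_iota1: "w \<in> keys (iota1 p) \<Longrightarrow> right w = 0"
proof (induct p rule: pol_induct)
  case (mon u)
  then show ?case
    by (intro poly_mapping_eqI) (auto simp: iota1_mon lookup_right lookup_emb1)
next
  case (add p q)
  then show ?case using keys_add[of "iota1 p" "iota1 q"] by (auto simp: iota_add)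
qed simp

lemma keys_iota2: "w \<in> keys (iota2 p) \<Longrightarrow> left w = 0"
proof (induct p rule: pol_induct)
  case (mon u)
  then show ?case
    by (intro poly_mapping_eqI) (auto simp: iota2_mon lookup_left lookup_emb2)
next
  case (add p q)
  then show ?case using keys_add[of "iota2 p" "iota2 q"] by (auto simp: iota_add)
qed simp

text \<open>After cancelling the smaller power of v_n, reduction modulo v_n either makes one side
  vanish although a monomial without v_n occurs in it, or leaves \<open>W\<close> equal to the
  single monomial \<open>wd\<close>, although \<open>w\<close> occurs in \<open>W\<close>.\<close>

lemma v_adic_leading_terms_differ:
  assumes W: "lookup W w = 1" "lookup w 0 = 0" and wd: "lookup wd 0 = 0" "w \<noteq> wd"
    and eq: "var 0 ^ b * W = var 0 ^ N * (mon wd + var 0 * E)"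
  shows False
proof -
  consider "b < N" | "b = N" | "N < b" by linarith
  then show False
  proof cases
    case 1
    then obtain k where "N = b + Suc k" using less_imp_Suc_add by auto
    then have "var 0 ^ b * W = var 0 ^ b * (var 0 * (var 0 ^ k * (mon wd + var 0 * E)))"
      using eq by (simp add: power_add mult.assoc)
    then have "W = var 0 * (var 0 ^ k * (mon wd + var 0 * E))" by simp
    then show False using W lookup_v_mult_0[OF W(2)] by simp
  next
    case 2
    then have "W = mon wd + var 0 * E" using eq by simp
    then show False using W wd lookup_v_mult_0[OF W(2)] by (simp add: lookup_add lookup_mon)
  next
    case 3
    then obtain k where "b = N + Suc k" using less_imp_Suc_add by auto
    then have "var 0 ^ N * (mon wd + var 0 * E) = var 0 ^ N * (var 0 * (var 0 ^ k * W))"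
      using eq by (simp add: power_add mult.assoc)
    then have "mon wd + var 0 * E = var 0 * (var 0 ^ k * W)" by simp
    then have "lookup (mon wd + var 0 * E) wd = 0" using lookup_v_mult_0[OF wd(1)] by simp
    then show False using lookup_v_mult_0[OF wd(1)] by (simp add: lookup_add lookup_mon)
  qed
qed

section \<open>A saturated bi-ideal and its reductions modulo v_n\<close>

locale saturated_biideal =
  fixes n m :: nat and I :: "pol set"
  assumes n1: "n \<ge> 1" and good: "good_ideal n m I"
begin

abbreviation "s \<equiv> s_of m"
abbreviation "s0 \<equiv> s_of (m0_of n m)"
abbreviation "I0 \<equiv> ideal_of (I \<union> JR n s0)"
abbreviation "K \<equiv> ideal_of (I \<union> {var 0})"
abbreviation "K0 \<equiv> ideal_of (I0 \<union> {var 0})"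
abbreviation "ZK \<equiv> {j. j \<ge> 1 \<and> var j \<in> K}"
abbreviation "Z0 \<equiv> {j. j \<ge> 1 \<and> var j \<in> K0}"

lemma I: "is_ideal I" "JR n s \<subseteq> I" "homogeneous_set n I"
  and I_Delta: "x \<in> I \<Longrightarrow> Delta n s x \<in> tens_ideal I"
  and I_aug: "I \<subseteq> ideal_of {var i | i. i \<ge> 1}"
  and I0_sat: "var 0 * x \<in> I0 \<Longrightarrow> x \<in> I0"
  using good unfolding good_ideal_def Let_def tens_ideal_def by blast+

lemma I_sub_I0: "I \<subseteq> I0" and JR_sub_I0: "JR n s0 \<subseteq> I0"
  and I0_sub_K0: "I0 \<subseteq> K0" and v_K0: "var 0 \<in> K0" and I_sub_K: "I \<subseteq> K" and v_K: "var 0 \<in> K"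
  using ideal_of_subset[of "I \<union> JR n s0"] ideal_of_subset[of "I0 \<union> {var 0}"]
    ideal_of_subset[of "I \<union> {var 0}"] by blast+

lemma K_sub_K0: "K \<subseteq> K0"
  by (rule ideal_of_least) (use I_sub_I0 I0_sub_K0 v_K0 in auto)

lemma I0_sat_power: "var 0 ^ k * x \<in> I0 \<Longrightarrow> x \<in> I0"
  by (induct k) (auto simp: mult.assoc dest: I0_sat)

lemma s0_le: "s0 \<le> s" "int s0 \<le> 2 ^ n - 1" "s0 = s \<or> s0 = 2 ^ n - 1"
proof -
  have "(1::nat) \<le> 2 ^ n" by simp
  then have "int (2 ^ n - 1) = 2 ^ n - 1" by (simp add: of_nat_diff)
  moreover have "int s0 \<le> int (2 ^ n - 1)"
    unfolding s_of_m0_of of_nat_le_iff by (rule min.cobounded2)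
  ultimately show "int s0 \<le> 2 ^ n - 1" by linarith
  show "s0 \<le> s" "s0 = s \<or> s0 = 2 ^ n - 1"
    unfolding s_of_m0_of by (auto simp: min_def)
qed

lemma K_no_const: "p \<in> K \<Longrightarrow> lookup p 0 = 0" and K0_no_const: "p \<in> K0 \<Longrightarrow> lookup p 0 = 0"
proof -
  let ?C = "{p::pol. lookup p 0 = 0}"
  have "ideal_of {var i | i. i \<ge> 1} \<subseteq> ?C"
    by (rule ideal_of_least[OF is_ideal_no_const]) (auto simp: var_no_const)
  then have 1: "I \<subseteq> ?C" using I_aug by blast
  then have 2: "I0 \<subseteq> ?C"
    by (intro ideal_of_least[OF is_ideal_no_const]) (auto dest: JR_no_const)
  have "K \<subseteq> ?C" "K0 \<subseteq> ?C"
    using 1 2 by (intro ideal_of_least[OF is_ideal_no_const]; auto simp: var_no_const)+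
  then show "p \<in> K \<Longrightarrow> lookup p 0 = 0" "p \<in> K0 \<Longrightarrow> lookup p 0 = 0" by blast+
qed

lemma hom_I0: "homogeneous_set n I0"
proof (rule homogeneous_ideal_of)
  fix g d assume "g \<in> I \<union> JR n s0"
  then have "hcomp n d g \<in> I \<union> JR n s0"
    using I(3) homogeneous_JR[of n s0] by (auto simp: homogeneous_set_def)
  then show "hcomp n d g \<in> I0" using ideal_of_subset by blast
qed

lemma delta_K: "p \<in> K \<Longrightarrow> delta p \<in> tens_ideal K"
  unfolding delta_def
proof (erule subst_ideal_of[OF is_ideal_tens_ideal, rotated], fold delta_def)
  fix g assume "g \<in> I \<union> {var 0}"
  then consider "g \<in> I" | "g = var 0" by blast
  then show "delta g \<in> tens_ideal K"
  proof cases
    case 1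
    have "Delta n s g \<in> tens_ideal K" using I_Delta[OF 1] tens_ideal_mono[OF I_sub_K] by blast
    moreover have "delta g + Delta n s g \<in> tens_ideal K"
      by (rule delta_cong_Delta) (use I_sub_K I(2) v_K in auto)
    ultimately show ?thesis by (rule is_ideal_add_cancel[OF is_ideal_tens_ideal, rotated])
  next
    case 2
    then show ?thesis using iota_mem_tens_ideal(1)[OF v_K] by simp
  qed
qed

lemma delta_K0: "p \<in> K0 \<Longrightarrow> delta p \<in> tens_ideal K0"
proof -
  let ?A = "{x. subst delta_img x \<in> tens_ideal K0}"
  have A: "is_ideal ?A" by (rule is_ideal_subst_vimage) simp
  have K: "K \<subseteq> ?A" using delta_K tens_ideal_mono[OF K_sub_K0] by (auto simp: delta_def)
  have "rels n s0 \<subseteq> ?A"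
  proof
    fix g assume g: "g \<in> rels n s0"
    then have "g \<in> K0" using rels_JR JR_sub_I0 I0_sub_K0 by blast
    then have "delta g \<in> tens_ideal K0"
      unfolding delta_rels[OF g]
      by (intro is_ideal_add[OF is_ideal_tens_ideal] iota_mem_tens_ideal)
    then show "g \<in> ?A" by (simp add: delta_def)
  qed
  then have "JR n s0 \<subseteq> ?A" using ideal_of_least[OF A] JR_def by metis
  then have "I0 \<subseteq> ?A" using K I_sub_K by (intro ideal_of_least[OF A]) auto
  then have "K0 \<subseteq> ?A" using K v_K by (intro ideal_of_least[OF A]) auto
  then show "p \<in> K0 \<Longrightarrow> delta p \<in> tens_ideal K0" by (auto simp: delta_def)
qed

lemma dbl_I: "dbl_closed I" and dbl_I0: "dbl_closed I0" and dbl_K: "dbl_closed K" and dbl_K0: "dbl_closed K0"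
proof -
  show "dbl_closed I" by (rule dbl_closed_JR[OF I(1,2)])
  show "dbl_closed I0" by (rule dbl_closed_JR[OF _ JR_sub_I0]) simp
  show "dbl_closed K" by (rule dbl_closed_JR[of _ n s]) (use I(2) I_sub_K in auto)
  show "dbl_closed K0" by (rule dbl_closed_JR[of _ n s0]) (use JR_sub_I0 I0_sub_K0 in auto)
qed

lemma K_not_normal: "x \<in> K \<Longrightarrow> u \<in> keys (sred x) \<Longrightarrow> lookup u 0 = 0 \<Longrightarrow> \<not> normal ZK u"
  by (rule biideal_mod_v[OF dbl_K v_K homogeneous_insert_v[OF I(3)] K_no_const delta_K])

lemma K0_not_normal: "x \<in> K0 \<Longrightarrow> u \<in> keys (sred x) \<Longrightarrow> lookup u 0 = 0 \<Longrightarrow> \<not> normal Z0 u"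
  by (rule biideal_mod_v[OF dbl_K0 v_K0 homogeneous_insert_v[OF hom_I0] K0_no_const delta_K0])

section \<open>Comparison of H with H_0\<close>

lemma above_s0: "j > s0 \<Longrightarrow> 2 ^ n \<le> j \<or> var j \<in> JR n s"
  using s0_le(3) var_mem_JR[of s j n] by auto

lemma v_var_above_s0: "j > s0 \<Longrightarrow> var 0 * var j \<in> JR n s"
  using above_s0[of j] v_var_mem_JR is_ideal_mult[OF is_ideal_JR] by blast

text \<open>Bounds the kernel of the map from H to H_0 by the ideal of the e_j with j > s0, each of
  which v_n kills in H.\<close>

lemma JR_s0_sub: "JR n s0 \<subseteq> ideal_of (JR n s \<union> {var j | j. j > s0})"
  unfolding JR_def[of n s0]
proof (rule ideal_of_mono, rule subsetI)
  let ?G = "JR n s \<union> {var j | j. j > s0}"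
  fix g assume "g \<in> rels n s0"
  then consider i where "1 \<le> i" "g = var i ^ 2 + eR s0 (2 * i)" | j where "j > s0" "g = var j"
    | i where "2 ^ n \<le> i" "g = var 0 * var i"
    by (fastforce simp: rels_def)
  then show "g \<in> ideal_of ?G"
  proof cases
    case 1
    have "var i ^ 2 + var (2 * i) \<in> ideal_of ?G"
      using square_mem_JR[OF 1(1), of n s] ideal_of_subset[of ?G] by blast
    moreover have "var (2 * i) + eR s0 (2 * i) \<in> ideal_of ?G"
      using 1(1) ideal_of_subset[of ?G] is_ideal_0[OF is_ideal_ideal_of, of ?G]
      by (auto simp: eR_def not_le)
    ultimately have "(var i ^ 2 + var (2 * i)) + (var (2 * i) + eR s0 (2 * i)) \<in> ideal_of ?G"
      by (rule is_ideal_add[OF is_ideal_ideal_of])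
    then show ?thesis using 1(2) by (simp add: add.assoc)
  next
    case 2
    then show ?thesis using ideal_of_subset[of ?G] by blast
  next
    case 3
    then show ?thesis using v_var_mem_JR[OF 3(1), of s] ideal_of_subset[of ?G] by blast
  qed
qed

lemma I0_sub: "I0 \<subseteq> ideal_of (I \<union> {var j | j. j > s0})"
proof (rule ideal_of_mono)
  let ?G = "I \<union> {var j | j. j > s0}"
  have "ideal_of (JR n s \<union> {var j | j. j > s0}) \<subseteq> ideal_of ?G"
    by (rule ideal_of_mono) (use I(2) ideal_of_subset[of ?G] in blast)
  then show "I \<union> JR n s0 \<subseteq> ideal_of ?G"
    using JR_s0_sub ideal_of_subset[of ?G] by blast
qed

lemma v_I0: "x \<in> I0 \<Longrightarrow> var 0 * x \<in> I"
proof -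
  have "ideal_of (I \<union> {var j | j. j > s0}) \<subseteq> {x. var 0 * x \<in> I}"
    by (rule ideal_of_least[OF is_ideal_quotient[OF I(1)]])
      (use v_var_above_s0 I(2) is_ideal_mult[OF I(1)] in auto)
  then show "x \<in> I0 \<Longrightarrow> var 0 * x \<in> I" using I0_sub by blast
qed

text \<open>The kernel of \<open>H \<rightarrow> H\<^sub>0\<close> is killed by \<open>v\<^sub>n\<close> and hence vanishes in degrees below \<open>2 ^ n\<close>.\<close>

lemma low_degree: "x \<in> I0 \<Longrightarrow> d \<le> 2 ^ n - 1 \<Longrightarrow> hcomp n d x \<in> I"
proof -
  assume x: "x \<in> I0" and d: "d \<le> 2 ^ n - 1"
  have "x \<in> ideal_of (I \<union> {var j | j. j > s0})" using x I0_sub by blast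
  then show ?thesis
  proof (induct rule: ideal_of_additive_induct)
    case zero
    show ?case by (simp add: is_ideal_0[OF I(1)])
  next
    case (add x y)
    then show ?case by (simp add: hcomp_add is_ideal_add[OF I(1)])
  next
    case (mult c g)
    show ?case
    proof (cases "g \<in> I")
      case True
      then show ?thesis using is_ideal_mult[OF I(1)] I(3) by (auto simp: homogeneous_set_def)
    next
      case False
      then obtain j where j: "g = var j" "j > s0" using mult by blast
      then have j2: "2 ^ n \<le> j" using above_s0[OF j(2)] False I(2) by auto
      then have j3: "int j \<ge> 2 ^ n" by (metis of_nat_le_iff of_nat_numeral of_nat_power)
      have j0: "j \<noteq> 0" using j2 by (metis not_less zero_less_numeral zero_less_power)
      show ?thesis
      proof (induct c rule: pol_induct)
        case (mon u)
        show ?case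
        proof (cases "mdeg n u + int j = d")
          case True
          \<comment> \<open>The cofactor of e_j has negative degree, hence contains v_n, and v_n e_j
            is zero in H.\<close>
          then have "mdeg n u < 0" using j3 d by linarith
          then have "lookup u 0 \<noteq> 0" using mdeg_nonneg[of u n] by fastforce
          then have "mon u * g = mon (u - single 0 1) * (var 0 * var j)"
            by (simp add: mon_v_factor j mult_ac)
          moreover have "\<dots> \<in> I"
            by (rule is_ideal_mult[OF I(1)]) (use v_var_above_s0[OF j(2)] I(2) in blast)
          moreover have "hcomp n d (mon u * g) = mon u * g"
            using True j0 by (simp add: j var_eq_mon mon_mult hcomp_mon mdeg_add mdeg_single wt_def)
          ultimately show ?thesis by simp
        next
          case False
          then have "hcomp n d (mon u * g) = 0"
            using j0 by (simp add: j var_eq_mon mon_mult hcomp_mon mdeg_add mdeg_single wt_def)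
          then show ?thesis by (simp add: is_ideal_0[OF I(1)])
        qed
      qed (auto simp: is_ideal_0[OF I(1)] is_ideal_add[OF I(1)] distrib_right hcomp_add)
    qed
  qed
qed

lemma low_var: "j \<ge> 1 \<Longrightarrow> j \<le> s0 \<Longrightarrow> var j \<in> I0 \<Longrightarrow> var j \<in> I"
  using low_degree[of "var j" "int j"] s0_le(2)
  by (simp add: var_eq_mon hcomp_mon mdeg_var)

section \<open>Normal forms modulo I_0 and in its tensor square\<close>

lemma Z0_above: "{j. j > s0} \<subseteq> Z0"
  using var_mem_JR[of s0 _ n] JR_sub_I0 I0_sub_K0 by force

lemma NF_exists: "\<exists>p. (\<forall>u\<in>keys p. normal Z0 u) \<and> x + p \<in> I0"
proof (rule normal_form_exists[OF n1 is_ideal_ideal_of JR_sub_I0 Z0_above])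
  fix j assume "j \<in> Z0"
  then have j: "j \<ge> 1" "var j \<in> K0" by auto
  obtain i y where iy: "i \<in> I0" "var j = i + var 0 * y"
    using ideal_of_insert_decomp[OF is_ideal_ideal_of j(2)] by blast
  \<comment> \<open>As v_n has degree 1 - 2^n, the component of degree j of \<open>var 0 * y\<close>
    comes from this component of y.\<close>
  let ?y = "hcomp n (int j + 2 ^ n - 1) y"
  have "hcomp n (int j) (var j) = hcomp n (int j) i + hcomp n (int j) (mon (single 0 1) * y)"
    by (simp only: iy(2) hcomp_add var_eq_mon[of 0])
  moreover have "hcomp n (int j) (var j) = var j"
    using j by (simp add: var_eq_mon hcomp_mon mdeg_var)
  moreover have "hcomp n (int j) (mon (single 0 1) * y) = var 0 * ?y"
    unfolding hcomp_mon_mult by (simp add: mdeg_single wt_def var_eq_mon algebra_simps)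
  ultimately have "var j + var 0 * ?y = hcomp n (int j) i"
    by (simp add: add.assoc)
  then have "var j + var 0 * ?y \<in> I0" using iy(1) hom_I0 by (simp add: homogeneous_set_def)
  then show "\<exists>y. (\<forall>u\<in>keys y. mdeg n u = int j + 2 ^ n - 1) \<and> var j + var 0 * y \<in> I0"
    by (intro exI[of _ ?y]) (auto simp: keys_hcomp)
qed

lemma sred_normal: "(\<And>u. u \<in> keys p \<Longrightarrow> normal Z u) \<Longrightarrow> sred p = p"
  by (rule sred_id) (simp add: normal_def)

text \<open>This gives uniqueness of normal forms, and here saturation enters: dividing by the
  highest power of v_n stays inside \<open>I0\<close> and produces a normal monomial without v_n,
  which \<open>K0_not_normal\<close> excludes.\<close>

lemma normal_I0_zero:
  assumes p: "\<And>u. u \<in> keys p \<Longrightarrow> normal Z0 u" and "p \<in> I0"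
  shows "p = 0"
proof (rule ccontr)
  assume "p \<noteq> 0"
  then obtain b q u where q: "p = var 0 ^ b * q" "u \<in> keys q" "lookup u 0 = 0" by (rule v_factor)
  have nq: "normal Z0 w" if "w \<in> keys q" for w
    using p[of "w + single 0 b"] keys_v_power[of w q b] that q(1) normal_add_v by auto
  have "q \<in> K0" using I0_sat_power \<open>p \<in> I0\<close> q(1) I0_sub_K0 by blast
  then have "\<not> normal Z0 u" using K0_not_normal[of q u] sred_normal[OF nq] q by auto
  then show False using nq q(2) by blast
qed

definition NF :: "pol \<Rightarrow> pol" where
  "NF x = (SOME p. (\<forall>u\<in>keys p. normal Z0 u) \<and> x + p \<in> I0)"

lemma NF: "u \<in> keys (NF x) \<Longrightarrow> normal Z0 u" "x + NF x \<in> I0"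
  using someI_ex[OF NF_exists[of x]] unfolding NF_def by blast+

lemma NF_eq:
  assumes "\<And>u. u \<in> keys p \<Longrightarrow> normal Z0 u" "x + p \<in> I0"
  shows "NF x = p"
proof -
  have "(x + p) + (x + NF x) \<in> I0" by (rule is_ideal_add[OF _ assms(2) NF(2)]) simp
  then have "p + NF x \<in> I0" by (simp add: add_ac)
  moreover have "normal Z0 u" if "u \<in> keys (p + NF x)" for u
    using that keys_add[of p "NF x"] assms(1) NF(1) by blast
  ultimately have "p + NF x = 0" by (intro normal_I0_zero)
  then show ?thesis by (metis add_self_left add.right_neutral)
qed

lemma NF_id: "(\<And>u. u \<in> keys p \<Longrightarrow> normal Z0 u) \<Longrightarrow> NF p = p"
  by (rule NF_eq) (simp_all add: is_ideal_0)

lemma NF_I0: "x \<in> I0 \<Longrightarrow> NF x = 0"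
  by (rule NF_eq) simp_all

lemma vlin_NF: "vlin NF"
  unfolding vlin_def additive_def
proof (intro conjI allI)
  fix p q
  show "NF (p + q) = NF p + NF q"
  proof (rule NF_eq)
    show "u \<in> keys (NF p + NF q) \<Longrightarrow> normal Z0 u" for u
      using keys_add[of "NF p" "NF q"] NF(1) by blast
    have "(p + NF p) + (q + NF q) \<in> I0" by (rule is_ideal_add) (simp_all add: NF)
    then show "p + q + (NF p + NF q) \<in> I0" by (simp add: add_ac)
  qed
  show "NF (var 0 * p) = var 0 * NF p"
  proof (rule NF_eq)
    show "normal Z0 u" if u: "u \<in> keys (var 0 * NF p)" for u
    proof -
      obtain w where "w \<in> keys (NF p)" "u = single 0 1 + w"
        using u keys_mult[of "var 0" "NF p"] by (auto simp: var_eq_mon)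
      then show ?thesis using NF(1) normal_add_v[of Z0 w 1] by (simp add: add.commute)
    qed
    have "var 0 * (p + NF p) \<in> I0" by (rule is_ideal_mult) (simp_all add: NF)
    then show "var 0 * p + var 0 * NF p \<in> I0" by (simp add: distrib_left)
  qed
qed

abbreviation "NF2 \<equiv> tens NF NF"

lemma NF2_tens_I0: "z \<in> tens_ideal I0 \<Longrightarrow> NF2 z = 0"
proof -
  assume "z \<in> tens_ideal I0"
  then have "NF2 z \<in> {0}"
    by (intro tens_ideal_image[OF vlin_NF vlin_NF is_ideal_ideal_of[of "I \<union> JR n s0"]])
      (simp_all add: NF_I0)
  then show ?thesis by simp
qed

lemma NF2_cong: "z + z' \<in> tens_ideal I0 \<Longrightarrow> NF2 z = NF2 z'"
  using NF2_tens_I0[of "z + z'"] by (metis tens_add add_self_left add.right_neutral add.commute)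

lemma NF2_tens_K0: "z \<in> tens_ideal K0 \<Longrightarrow> \<exists>E. NF2 z = var 0 * E"
proof -
  assume z: "z \<in> tens_ideal K0"
  have NFK: "\<exists>q. NF x = var 0 * q" if x: "x \<in> K0" for x
  proof -
    obtain i y where "i \<in> I0" "x = i + var 0 * y"
      using ideal_of_insert_decomp[OF is_ideal_ideal_of x] by blast
    then have "NF x = var 0 * NF y" using vlin_NF NF_I0 by (simp add: vlin_def additiveD)
    then show ?thesis by blast
  qed
  let ?C = "{z. \<exists>q. z = var 0 * q}"
  have "NF2 z \<in> ?C"
  proof (rule tens_ideal_image[OF vlin_NF vlin_NF is_ideal_ideal_of _ _ _ _ z])
    show "0 \<in> ?C" by (auto intro: exI[of _ 0])
    show "x + y \<in> ?C" if "x \<in> ?C" "y \<in> ?C" for x y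
      using that by (auto simp: distrib_left[symmetric])
  next
    fix a x y assume "x \<in> K0"
    then obtain q where "NF x = var 0 * q" using NFK by blast
    then have "var 0 ^ a * iota1 (NF x) * iota2 (NF y) = var 0 * (var 0 ^ a * iota1 q * iota2 (NF y))"
      by (simp add: iota_mult mult_ac)
    then show "var 0 ^ a * iota1 (NF x) * iota2 (NF y) \<in> ?C" by blast
  next
    fix a x y assume "y \<in> K0"
    then obtain q where "NF y = var 0 * q" using NFK by blast
    then have "var 0 ^ a * iota1 (NF x) * iota2 (NF y) = var 0 * (var 0 ^ a * iota1 (NF x) * iota2 q)"
      by (simp add: iota_mult mult_ac)
    then show "var 0 ^ a * iota1 (NF x) * iota2 (NF y) \<in> ?C" by blast
  qed
  then show ?thesis by blast
qed

section \<open>Reduced coproducts in normal form\<close>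

lemma normal_0: "normal Z 0"
  by (simp add: normal_def odd_expo_def)

lemma NF2_iota: "NF2 (iota1 x * iota2 y) = iota1 (NF x) * iota2 (NF y)"
  using tens_apply[OF vlin_NF vlin_NF, of 0] by simp

lemma NF_1: "NF 1 = 1"
  by (rule NF_id) (simp add: normal_0)

text \<open>Modulo v_n one may use \<open>delta\<close>, and \<open>delta y\<close> is already in
  normal form: the two factors of each of its terms divide a normal monomial, and normality passes
  to divisors.\<close>

lemma NF2_reduced_coproduct:
  assumes y: "\<And>u. u \<in> keys y \<Longrightarrow> normal Z0 u"
  shows "\<exists>E. NF2 (Delta n s y + iota1 y + iota2 y) = delta y + iota1 y + iota2 y + var 0 * E"
proof -
  have "delta y + Delta n s y \<in> tens_ideal K0"
    by (rule delta_cong_Delta) (use v_K0 I(2) I_sub_I0 I0_sub_K0 in auto)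
  then obtain E where "NF2 (delta y + Delta n s y) = var 0 * E" using NF2_tens_K0 by blast
  then have 1: "NF2 (Delta n s y) = NF2 (delta y) + var 0 * E"
    by (metis tens_add add_self_left)
  have "NF2 (delta y) = filt (\<lambda>_. True) (delta y)"
  proof (rule additive_eq_filt[OF additive_tens])
    fix w assume "w \<in> keys (delta y)"
    then have "normal Z0 (merge w)" using keys_delta y by blast
    then have "normal Z0 (left w)" "normal Z0 (right w)"
      by (auto simp: merge_def dest!: normal_addD)
    then have "NF (mon (left w)) = mon (left w)" "NF (mon (right w)) = mon (right w)"
      by (auto intro!: NF_id)
    then have "NF2 (mon w) = mon w"
      unfolding tens_mon by (simp only: mon_tensor_split[of w, symmetric])
    then show "NF2 (mon w) = (if True then mon w else 0)" by simp
  qed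
  then have 2: "NF2 (delta y) = delta y" by (simp add: filt_id)
  have 3: "NF2 (iota1 y) = iota1 y" "NF2 (iota2 y) = iota2 y"
    using NF2_iota[of y 1] NF2_iota[of 1 y] NF_id[OF y] by (simp_all add: NF_1)
  show ?thesis by (intro exI[of _ E]) (simp add: tens_add 1 2 3 add_ac)
qed

lemma Delta_add: "Delta n s (p + q) = Delta n s p + Delta n s q"
  and Delta_v_power: "Delta n s (var 0 ^ b * p) = var 0 ^ b * Delta n s p"
  by (simp_all add: Delta_def subst_add subst_mult subst_power)

lemma var_power_cong_I0:
  assumes "i \<ge> 1"
  shows "iota1 (var i) ^ (2 ^ a) + iota1 (var (i * 2 ^ a)) \<in> tens_ideal I0"
    and "iota2 (var i) ^ (2 ^ a) + iota2 (var (i * 2 ^ a)) \<in> tens_ideal I0"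
  using iota_mem_tens_ideal[OF dbl_closed_power[OF dbl_I0 assms, of a]]
  by (simp_all add: iota_add iota_power)

text \<open>Modulo the relations e_j is the 2^a-th power of e_i, and Frobenius commutes with the
  coproduct.\<close>

lemma NF2_reduced_coproduct_var:
  assumes "odd i" "i * 2 ^ a \<le> s"
  shows "NF2 (Delta n s (var (i * 2 ^ a)) + iota1 (var (i * 2 ^ a)) + iota2 (var (i * 2 ^ a)))
    = NF2 (dtilde_odd n s i ^ (2 ^ a))"
proof (rule NF2_cong)
  let ?j = "i * 2 ^ a"
  have i: "i \<ge> 1" using assms(1) by (cases i) auto
  have "i \<le> ?j" by simp
  then have "i \<le> s" using assms(2) by (rule le_trans)
  then have e: "eL s i = iota1 (var i)" "eRt s i = iota2 (var i)"
    using i by (simp_all add: eL_def eRt_def iota_var)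
  have "Delta n s (var ?j) = (iota1 (var i) + iota2 (var i) + dtilde_odd n s i) ^ (2 ^ a)"
    using i delta_e_odd_power[OF assms, of n] by (simp add: Delta_def e)
  also have "\<dots> = iota1 (var i) ^ (2 ^ a) + iota2 (var i) ^ (2 ^ a) + dtilde_odd n s i ^ (2 ^ a)"
    by (simp only: frobenius)
  finally have "Delta n s (var ?j) + iota1 (var ?j) + iota2 (var ?j) + dtilde_odd n s i ^ (2 ^ a)
    = (iota1 (var i) ^ (2 ^ a) + iota1 (var ?j)) + (iota2 (var i) ^ (2 ^ a) + iota2 (var ?j))"
    by (simp add: add_ac)
  then show "Delta n s (var ?j) + iota1 (var ?j) + iota2 (var ?j) + dtilde_odd n s i ^ (2 ^ a) \<in> tens_ideal I0"
    using is_ideal_add[OF is_ideal_tens_ideal var_power_cong_I0[OF i, of a]] by (simp only:)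
qed

text \<open>\<open>Z0\<close> is closed under doubling, since squares of members of
  \<open>K0\<close> lie in \<open>K0\<close>. So i * 2^b in \<open>Z0\<close> forces b > a.\<close>

lemma normal_single:
  assumes "odd i" "i * 2 ^ a \<notin> Z0"
  shows "normal Z0 (single i (2 ^ a))"
proof -
  have "(2::nat) ^ a < 2 ^ b" if b: "i * 2 ^ b \<in> Z0" for b
  proof (rule ccontr)
    assume "\<not> (2::nat) ^ a < 2 ^ b"
    then have "b \<le> a" by simp
    then have ab: "i * 2 ^ a = (i * 2 ^ b) * 2 ^ (a - b)" by (simp add: mult.assoc flip: power_add)
    have ib: "i * 2 ^ b \<ge> 1" using b by blast
    have "var (i * 2 ^ b) ^ (2 ^ (a - b)) \<in> K0"
    proof -
      have "(2::nat) ^ (a - b) = Suc (2 ^ (a - b) - 1)" by simp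
      then have "var (i * 2 ^ b) ^ (2 ^ (a - b)) = var (i * 2 ^ b) * var (i * 2 ^ b) ^ (2 ^ (a - b) - 1)"
        by (metis power_Suc)
      then show ?thesis using b by (simp add: is_ideal_mult_right[OF is_ideal_ideal_of])
    qed
    then have "var (i * 2 ^ a) \<in> K0"
      unfolding ab dbl_closed_var_iff[OF dbl_K0 ib] .
    moreover have "i * 2 ^ a \<ge> 1" using assms(1) by (simp add: Suc_le_eq odd_pos)
    ultimately show False using assms(2) by blast
  qed
  then show ?thesis
    using assms(1) by (auto simp: normal_def odd_expo_def lookup_single when_def)
qed

text \<open>For the largest \<open>j\<close> violating the claim, the generator \<open>e\<^sub>j\<close> equals \<open>v\<^sub>n ^ b * y\<close> in the
  quotient, where \<open>y\<close> is in normal form, not divisible by \<open>v\<^sub>n\<close> and of degree larger than that of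
  any generator. So \<open>y\<close> is not primitive modulo \<open>v\<^sub>n\<close>, and the leading coefficient of its reduced
  coproduct has an off-diagonal term. But the leading coefficient of the reduced coproduct
  of \<open>e\<^sub>j\<close> is diagonal.\<close>

lemma var_Z0_mem_I0:
  assumes "j \<in> Z0"
  shows "var j \<in> I0"
proof (rule ccontr)
  assume "var j \<notin> I0"
  define B where "B = {j \<in> Z0. var j \<notin> I0}"
  have B: "B \<subseteq> {..s0}"
  proof
    fix i assume "i \<in> B"
    then have "\<not> i > s0" using var_mem_JR[of s0 i n] JR_sub_I0 by (auto simp: B_def)
    then show "i \<in> {..s0}" by simp
  qed
  then have fin: "finite B" by (rule finite_subset) simp
  have "B \<noteq> {}" using assms \<open>var j \<notin> I0\<close> by (auto simp: B_def)
  define j where "j = Max B"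
  have jB: "j \<in> B" unfolding j_def using fin \<open>B \<noteq> {}\<close> by (rule Max_in)
  have above: "var i \<in> I0" if "i \<in> Z0" "i > j" for i
  proof (rule ccontr)
    assume "var i \<notin> I0"
    then have "i \<le> j" unfolding j_def using that fin by (intro Max_ge) (auto simp: B_def)
    then show False using that by simp
  qed
  have j1: "j \<ge> 1" and jK: "var j \<in> K0" and jI: "var j \<notin> I0" and js0: "j \<le> s0"
    using jB B by (auto simp: B_def)
  have jn: "int j \<le> 2 ^ n - 1" using js0 s0_le(2) by linarith
  define p where "p = NF (var j)"
  have p: "var j + p \<in> I0" "\<And>u. u \<in> keys p \<Longrightarrow> normal Z0 u" using NF by (auto simp: p_def)
  have "p \<noteq> 0" using p(1) jI by auto
  have hj: "hcomp n (int j) (var j) = var j" using j1 by (simp add: var_eq_mon hcomp_mon mdeg_var)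
  have "hcomp n (int j) (var j + p) \<in> I0" using p(1) hom_I0 by (simp add: homogeneous_set_def)
  then have "var j + hcomp n (int j) p \<in> I0" by (simp add: hcomp_add hj)
  then have "NF (var j) = hcomp n (int j) p"
    by (rule NF_eq[rotated]) (use p(2) keys_hcomp[of n "int j" p] in blast)
  then have php: "hcomp n (int j) p = p" by (simp add: p_def)
  obtain b y u where y: "p = var 0 ^ b * y" and u: "u \<in> keys y" "lookup u 0 = 0"
    using v_factor[OF \<open>p \<noteq> 0\<close>] by blast
  have kp: "w + single 0 b \<in> keys p" if "w \<in> keys y" for w
    using that keys_v_power[of w y b] y by simp
  have yn: "normal Z0 w" if "w \<in> keys y" for w
    using p(2)[OF kp[OF that]] by (simp add: normal_add_v)
  \<comment> \<open>For b = 0 the element p itself would be a member of \<open>K0\<close> with a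
    normal monomial free of v_n.\<close>
  have "b \<noteq> 0"
  proof
    assume "b = 0"
    then have "p = y" using y by simp
    have "var j + p \<in> K0" using p(1) I0_sub_K0 by blast
    then have "p \<in> K0" using jK by (rule is_ideal_add_cancel_left[OF is_ideal_ideal_of])
    then show False
      using K0_not_normal[of p u] sred_normal[OF p(2)] u yn \<open>p = y\<close> by auto
  qed
  \<comment> \<open>Removing at least one v_n raises the degree by at least 2^n - 1, so u lies
    beyond the index of every generator of H_0.\<close>
  have "u + single 0 b \<in> keys (hcomp n (int j) p)" using kp[OF u(1)] php by simp
  then have "mdeg n u + (1 - 2 ^ n) * int b = int j"
    by (simp add: keys_hcomp mdeg_add mdeg_single wt_def)
  moreover have "(2 ^ n - 1) * 1 \<le> (2 ^ n - 1) * int b"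
    using \<open>b \<noteq> 0\<close> by (intro mult_left_mono) auto
  ultimately have degu: "mdeg n u \<ge> int j + 2 ^ n - 1" by (simp add: algebra_simps)
  then have "mdeg n u > 2 ^ n - 1" using j1 by linarith
  moreover from this have "mdeg n u > 0" using s0_le(2) by linarith
  then have "u \<noteq> 0" by auto
  ultimately have ubig: "u \<noteq> 0" "mdeg n u > 2 ^ n - 1" by simp_all
  obtain i a where ia: "i \<in> keys u" "i \<ge> 1" "2 ^ a \<le> lookup u i" "lookup u i < 2 ^ Suc a"
    using top_power_of_two[OF ubig(1) u(2)] by blast
  have oi: "odd i" using yn[OF u(1)] ia by (auto simp: normal_def odd_expo_def)
  \<comment> \<open>A power of two of one variable of this degree represents a generator of index
    above s0, whose index is in \<open>Z0\<close>; it would not be normal.\<close>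
  have une: "u \<noteq> single i (2 ^ a)"
  proof
    assume ui: "u = single i (2 ^ a)"
    then have "mdeg n u = int (i * 2 ^ a)" using ia(2) by (simp add: mdeg_var)
    then have "int (i * 2 ^ a) > int s0" using ubig(2) s0_le(2) by linarith
    then have "i * 2 ^ a \<in> Z0" using Z0_above by (simp only: of_nat_less_iff) blast
    then have "lookup u i < 2 ^ a" using yn[OF u(1)] oi unfolding normal_def by blast
    then show False using ui by simp
  qed
  define w where "w = split_expo u i a"
  have w0: "lookup w 0 = 0" using lookup_split_expo_0[OF ia(2)] u(2) by (simp add: w_def)
  have lw: "left w = single i (2 ^ a)" and rw: "right w = u - single i (2 ^ a)"
    using left_split_expo[OF ia(2)] right_split_expo[OF ia(2) u(2)] by (simp_all add: w_def)
  have "lookup (left w) i \<noteq> lookup 0 i" using lw by simp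
  then have lw0: "left w \<noteq> 0" by metis
  have uu: "u = single i (2 ^ a) + (u - single i (2 ^ a))"
    by (rule poly_mapping_eqI) (use ia(3) in \<open>auto simp: lookup_add lookup_minus lookup_single when_def\<close>)
  have rw0: "right w \<noteq> 0" using une uu rw by (metis add.right_neutral)
  define W where "W = NF2 (Delta n s y + iota1 y + iota2 y)"
  obtain E where E: "W = delta y + iota1 y + iota2 y + var 0 * E"
    using NF2_reduced_coproduct[OF yn] unfolding W_def by blast
  have "lookup (delta y) w = 1" unfolding w_def by (rule lookup_delta_split[OF u(1) ia(2-4)])
  moreover have "lookup (iota1 y) w = 0" using keys_iota1[of w y] rw0 by (metis in_keys_iff)
  moreover have "lookup (iota2 y) w = 0" using keys_iota2[of w y] lw0 by (metis in_keys_iff)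
  ultimately have Ww: "lookup W w = 1" by (simp add: E lookup_add lookup_v_mult_0[OF w0])
  then have W0: "W \<noteq> var 0 * z" for z using lookup_v_mult_0[OF w0] by auto

  \<comment> \<open>The coproduct condition is known for I only, so the relation e_j + p is first
    lifted from \<open>I0\<close> to \<open>I\<close>, which its degree j \<le> 2^n - 1
    permits.\<close>
  have "hcomp n (int j) (var j + p) \<in> I" by (rule low_degree[OF p(1) jn])
  then have xI: "var j + p \<in> I" by (simp add: hcomp_add hj php)
  then have "Delta n s (var j + p) \<in> tens_ideal I0"
    using I_Delta tens_ideal_mono[OF I_sub_I0] by blast
  then have "Delta n s (var j + p) + iota1 (var j + p) + iota2 (var j + p) \<in> tens_ideal I0"
    using p(1) by (intro is_ideal_add[OF is_ideal_tens_ideal] iota_mem_tens_ideal)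
  then have "(Delta n s (var j) + iota1 (var j) + iota2 (var j))
      + var 0 ^ b * (Delta n s y + iota1 y + iota2 y) \<in> tens_ideal I0"
    by (simp add: y Delta_add Delta_v_power iota_add iota_mult iota_power distrib_left add_ac)
  from NF2_cong[OF this] have
    eq: "NF2 (Delta n s (var j) + iota1 (var j) + iota2 (var j)) = var 0 ^ b * W"
    by (simp add: W_def tens_v_power[OF vlin_NF vlin_NF])

  define i0 a0 where "i0 = opart j" and "a0 = epart j"
  have j_eq: "j = i0 * 2 ^ a0" and oi0: "odd i0"
    using opart_epart[OF j1] odd_opart[OF j1] by (simp_all add: i0_def a0_def)
  have i01: "i0 \<ge> 1" using oi0 by (cases i0) auto
  define N :: nat where "N = 2 ^ a0"
  have N: "N \<ge> 1" by (simp add: N_def)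
  have eq2: "NF2 (dtilde_odd n s i0 ^ N) = var 0 ^ b * W"
    using NF2_reduced_coproduct_var[OF oi0, of a0] eq js0 s0_le(1) by (simp add: j_eq N_def)
  have Wnz: "var 0 ^ b * W \<noteq> 0" using W0[of 0] by simp
  have i0_le: "i0 \<le> 2 ^ n - 1"
  proof -
    have "i0 \<le> j" unfolding j_eq by simp
    then have "int i0 \<le> 2 ^ n - 1" using jn by linarith
    then have "int i0 < int (2 ^ n)" by simp
    then have "i0 < 2 ^ n" by (simp only: of_nat_less_iff)
    then show ?thesis by simp
  qed
  show False
  proof (cases "i0 = 2 ^ n - 1")
    case True
    have "a0 = 0"
    proof (rule ccontr)
      assume "a0 \<noteq> 0"
      then have "(2::nat) \<le> 2 ^ a0" by (metis power_increasing one_le_numeral power_one_right Suc_leI neq0_conv One_nat_def)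
      then have "i0 * 2 \<le> j" unfolding j_eq by (rule mult_le_mono2)
      moreover have "int i0 = 2 ^ n - 1" using True by (simp add: of_nat_diff)
      ultimately show False using jn i01 by linarith
    qed
    then have "N = 1" "j = i0" by (simp_all add: N_def j_eq)
    \<comment> \<open>Here the normal form of v_n e_j tensor e_j is v_n^(2b+1) times y tensor y. It
      would equal v_n^b W, although W is not divisible by v_n.\<close>
    have "dtilde_odd n s i0 = var 0 ^ 1 * iota1 (var j) * iota2 (var j)"
      using True \<open>j = i0\<close> j1 js0 s0_le(1)
      by (simp add: dtilde_odd_def eL_def eRt_def iota_var)
    then have "NF2 (dtilde_odd n s i0) = var 0 ^ 1 * iota1 p * iota2 p"
      using tens_apply[OF vlin_NF vlin_NF, of 1 "var j" "var j"] by (simp add: p_def)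
    also have "\<dots> = var 0 ^ b * (var 0 * (iota1 y * (var 0 ^ b * iota2 y)))"
      by (simp add: y iota_mult iota_power mult_ac)
    finally have "W = var 0 * (iota1 y * (var 0 ^ b * iota2 y))"
      using eq2 \<open>N = 1\<close> by simp
    then show False using W0 by blast
  next
    case False
    then have lt: "i0 < 2 ^ n - 1" using i0_le by simp
    define t where "t = angle n ((2 ^ n - 1 - i0) div 2)"
    have "odd ((2::nat) ^ n - 1)" using n1 by (simp add: even_diff_nat)
    then have "even (2 ^ n - 1 - i0)" using oi0 lt by (simp add: even_diff_nat)
    then obtain k where k: "2 ^ n - 1 - i0 = 2 * k" by (rule evenE)
    then have "t = 2 ^ n - 1 - k" by (simp add: t_def angle_def)
    \<comment> \<open>From 2t = 2^n - 1 + i0. Thus t * 2^a0 exceeds j, and the maximality of j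
      applies to it.\<close>
    then have it: "i0 < t" using lt k by linarith
    obtain G where G: "dtilde_odd n s i0 = var 0 * eL s t * eRt s t + var 0 ^ 2 * (eL s t + eRt s t) * G"
      using dtilde_odd_form[OF lt, of s] unfolding t_def by blast
    have "t \<le> s"
    proof (rule ccontr)
      assume "\<not> t \<le> s"
      then have "dtilde_odd n s i0 = 0" using G by (simp add: eL_def eRt_def)
      then show False using eq2 Wnz N by (simp add: additive_0 power_0_left)
    qed
    define X Y where "X = iota1 (var t ^ N)" and "Y = iota2 (var t ^ N)"
    have t1: "t \<ge> 1" using it by simp
    have "dtilde_odd n s i0 = var 0 * iota1 (var t) * iota2 (var t)
        + var 0 ^ 2 * (iota1 (var t) + iota2 (var t)) * G"
      using G t1 \<open>t \<le> s\<close> by (simp add: eL_def eRt_def iota_var)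
    then have dN: "dtilde_odd n s i0 ^ N = var 0 ^ N * X * Y + var 0 ^ (2 * N) * (X + Y) * G ^ N"
      unfolding X_def Y_def N_def
      by (simp only: frobenius power_mult_distrib iota_power power_mult)
    have wj: "t * 2 ^ a0 > j" unfolding j_eq using it by simp
    \<comment> \<open>Otherwise maximality puts e_t^N into \<open>I0\<close>. As every term of the
      reduced coproduct contains \<open>X * Y\<close> or \<open>X + Y\<close>, it would vanish in
      the quotient, against W being nonzero.\<close>
    have notin: "t * 2 ^ a0 \<notin> Z0"
    proof
      assume "t * 2 ^ a0 \<in> Z0"
      then have "var t ^ N \<in> I0"
        using above wj dbl_closed_var_iff[OF dbl_I0 t1] unfolding N_def by blast
      then have XY: "X \<in> tens_ideal I0" "Y \<in> tens_ideal I0"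
        unfolding X_def Y_def by (intro iota_mem_tens_ideal; assumption)+
      have 1: "var 0 ^ N * X * Y \<in> tens_ideal I0" using XY(2) by (rule is_ideal_mult[OF is_ideal_tens_ideal])
      have "X + Y \<in> tens_ideal I0" using XY by (rule is_ideal_add[OF is_ideal_tens_ideal])
      then have "var 0 ^ (2 * N) * (X + Y) \<in> tens_ideal I0" by (rule is_ideal_mult[OF is_ideal_tens_ideal])
      then have 2: "var 0 ^ (2 * N) * (X + Y) * G ^ N \<in> tens_ideal I0"
        by (rule is_ideal_mult_right[OF is_ideal_tens_ideal])
      have "dtilde_odd n s i0 ^ N \<in> tens_ideal I0"
        unfolding dN using 1 2 by (rule is_ideal_add[OF is_ideal_tens_ideal])
      then show False using eq2 Wnz NF2_tens_I0 by simp
    qed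
    \<comment> \<open>t may be even, so the normal form of e_t^N is a power of the generator indexed
      by the odd part of t * 2^a0.\<close>
    define i1 a1 where "i1 = opart (t * 2 ^ a0)" and "a1 = epart (t * 2 ^ a0)"
    have ta: "t * 2 ^ a0 \<ge> 1" using t1 by simp
    have t_eq: "t * 2 ^ a0 = i1 * 2 ^ a1" and oi1: "odd i1"
      using opart_epart[OF ta] odd_opart[OF ta] by (simp_all add: i1_def a1_def)
    have i11: "i1 \<ge> 1" using oi1 by (cases i1) auto
    define e where "e = single i1 ((2::nat) ^ a1)"
    have ne: "normal Z0 e" unfolding e_def using normal_single[OF oi1] notin t_eq by simp
    have "NF (var t ^ N) = mon e"
    proof (rule NF_eq)
      have "(var t ^ N + var (t * 2 ^ a0)) + (var i1 ^ (2 ^ a1) + var (i1 * 2 ^ a1)) \<in> I0"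
        unfolding N_def
        by (rule is_ideal_add[OF is_ideal_ideal_of dbl_closed_power[OF dbl_I0 t1] dbl_closed_power[OF dbl_I0 i11]])
      then show "var t ^ N + mon e \<in> I0" by (simp add: t_eq e_def var_power add_ac)
    qed (use ne in auto)
    then have "NF2 (X * Y) = iota1 (mon e) * iota2 (mon e)"
      unfolding X_def Y_def NF2_iota by simp
    also have "\<dots> = mon (emb1 e + emb2 e)" by (simp add: iota1_mon iota2_mon mon_mult)
    finally have D: "NF2 (X * Y) = mon (emb1 e + emb2 e)" .
    \<comment> \<open>Of the factor v_n^(2N) in the remainder, v_n^N is taken out and one more v_n
      is displayed, which leaves the exponent N - 1. So the diagonal monomial is the v_n-adic
      leading coefficient.\<close>
    define E' where "E' = var 0 ^ (N - 1) * NF2 ((X + Y) * G ^ N)"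
    have "NF2 (dtilde_odd n s i0 ^ N) = var 0 ^ N * NF2 (X * Y) + var 0 ^ (2 * N) * NF2 ((X + Y) * G ^ N)"
      unfolding dN tens_add mult.assoc by (simp only: tens_v_power[OF vlin_NF vlin_NF])
    also have "2 * N = N + Suc (N - 1)" using N by simp
    finally have "var 0 ^ b * W = var 0 ^ N * (mon (emb1 e + emb2 e) + var 0 * E')"
      using eq2 by (simp add: D E'_def power_add mult.assoc distrib_left)
    moreover have "lookup (emb1 e + emb2 e) 0 = 0"
      using i11 by (simp add: lookup_add lookup_emb1 lookup_emb2 e_def lookup_single when_def)
    \<comment> \<open>If w were diagonal, the exponent of e_i in u would be 2^(a+1), against 2^a
      being its top power of two.\<close>
    moreover have "w \<noteq> emb1 e + emb2 e"
    proof
      assume weq: "w = emb1 e + emb2 e"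
      have "left w = e" "right w = e"
        by (rule poly_mapping_eqI; use i11 in \<open>auto simp: weq lookup_left lookup_right lookup_add
            lookup_emb1 lookup_emb2 e_def lookup_single when_def\<close>)+
      then have "u - single i (2 ^ a) = single i (2 ^ a)" using lw rw by simp
      then have "lookup (u - single i (2 ^ a)) i = lookup (single i (2 ^ a)) i" by simp
      then have "lookup u i - 2 ^ a = 2 ^ a" by (simp add: lookup_minus)
      then show False using ia(3,4) by simp
    qed
    ultimately show False using v_adic_leading_terms_differ[OF Ww w0] by blast
  qed
qed

section \<open>Generators of I_0 and of I\<close>

lemma I0_generators: "I0 \<subseteq> ideal_of (JR n s0 \<union> {var j | j. j \<in> Z0})"
proof
  let ?L = "ideal_of (JR n s0 \<union> {var j | j. j \<in> Z0})"
  fix x assume x: "x \<in> I0"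
  have sub: "JR n s0 \<union> {var j | j. j \<in> Z0} \<subseteq> ?L" by (rule ideal_of_subset)
  have "\<exists>p. (\<forall>u\<in>keys p. normal Z0 u) \<and> x + p \<in> ?L"
  proof (rule normal_form_exists[OF n1 is_ideal_ideal_of _ Z0_above])
    show "JR n s0 \<subseteq> ?L" using sub by blast
    \<comment> \<open>In this ideal the generators need no correction term, so y = 0 serves. The
      resulting normal form of x still lies in \<open>I0\<close>, where it must be zero.\<close>
    show "\<exists>y. (\<forall>u\<in>keys y. mdeg n u = int j + 2 ^ n - 1) \<and> var j + var 0 * y \<in> ?L"
      if "j \<in> Z0" for j
      using that sub by (intro exI[of _ 0]) auto
  qed
  then obtain p where p: "\<forall>u\<in>keys p. normal Z0 u" "x + p \<in> ?L" by blast
  have "?L \<subseteq> I0" by (rule ideal_of_least) (use JR_sub_I0 var_Z0_mem_I0 in auto)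
  then have "p \<in> I0" using p(2) x is_ideal_add_cancel_left[OF is_ideal_ideal_of] by blast
  then have "p = 0" using p(1) by (intro normal_I0_zero) auto
  then show "x \<in> ?L" using p(2) by simp
qed

text \<open>Up to s0 the degree is low enough to lift membership from \<open>I0\<close>. Above s0
  the generator is in \<open>I0\<close> anyway, hence so is its correction term v_n y; saturation
  gives y in \<open>I0\<close>, and v_n times \<open>I0\<close> lies in \<open>I\<close>.\<close>

lemma var_ZK_mem_I:
  assumes "j \<in> ZK"
  shows "var j \<in> I"
proof (cases "j \<le> s0")
  case True
  have "j \<in> Z0" using assms K_sub_K0 by blast
  then show ?thesis using True assms low_var[OF _ True var_Z0_mem_I0] by simp
next
  case False
  have "var j \<in> K" using assms by simp
  then obtain i y where iy: "i \<in> I" "var j = i + var 0 * y"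
    using ideal_of_insert_decomp[OF I(1)] by blast
  have "var j \<in> I0" using False var_mem_JR JR_sub_I0 by auto
  then have "var 0 * y \<in> I0"
    using iy I_sub_I0 is_ideal_add_cancel_left[OF is_ideal_ideal_of, of i "var 0 * y"] by auto
  then have "var 0 * y \<in> I" using I0_sat v_I0 by blast
  then show ?thesis using iy is_ideal_add[OF I(1)] by simp
qed

text \<open>The right-hand side depends on \<open>I\<close> only through \<open>K\<close>, which is
  what makes I determined by its image modulo v_n. The part of \<open>sred x\<close> free of v_n is
  settled modulo v_n; the rest is v_n y with y in \<open>I0\<close>, for which the generators of
  \<open>I0\<close> are available.\<close>

lemma generated_by_vars: "I = ideal_of (JR n s \<union> {var j | j. j \<in> ZK})"
proof
  let ?G = "JR n s \<union> {var j | j. j \<in> ZK}"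
  have sub: "?G \<subseteq> ideal_of ?G" by (rule ideal_of_subset)
  have dbl: "dbl_closed (ideal_of ?G)" by (rule dbl_closed_JR[of _ n s]) (use sub in auto)
  show LI: "ideal_of ?G \<subseteq> I" by (rule ideal_of_least[OF I(1)]) (use I(2) var_ZK_mem_I in auto)
  have vI0: "var 0 * y \<in> ideal_of ?G" if "y \<in> I0" for y
  proof -
    let ?Q = "{y. var 0 * y \<in> ideal_of ?G}"
    have Q: "is_ideal ?Q" by (rule is_ideal_quotient) simp
    have "ideal_of (JR n s \<union> {var j | j. j > s0}) \<subseteq> ?Q"
      by (rule ideal_of_least[OF Q])
        (use v_var_above_s0 sub is_ideal_mult[OF is_ideal_JR] in blast)
    then have 1: "JR n s0 \<subseteq> ?Q" using JR_s0_sub by blast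
    have "var j \<in> ?Q" if j: "j \<in> Z0" for j
    proof (cases "j \<le> s0")
      case True
      then have "var j \<in> I" using low_var var_Z0_mem_I0[OF j] j by auto
      then have "j \<in> ZK" using I_sub_K j by auto
      then have "var j \<in> ideal_of ?G" using sub by auto
      then show ?thesis using is_ideal_mult[OF is_ideal_ideal_of] by blast
    next
      case False
      then show ?thesis using v_var_above_s0[of j] sub by auto
    qed
    then have "ideal_of (JR n s0 \<union> {var j | j. j \<in> Z0}) \<subseteq> ?Q"
      using 1 by (intro ideal_of_least[OF Q]) auto
    then show ?thesis using I0_generators that by blast
  qed
  show "I \<subseteq> ideal_of ?G"
  proof
    fix x assume x: "x \<in> I"
    let ?P = "\<lambda>u. lookup u 0 = 0"
    have "mon u \<in> ideal_of ?G" if "u \<in> keys (sred x)" "lookup u 0 = 0" for u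
    proof (rule not_normal_mem[OF dbl keys_sred[OF that(1)]])
      show "\<not> normal ZK u" using K_not_normal that x I_sub_K by blast
      show "j \<in> ZK \<Longrightarrow> var j \<in> ideal_of ?G" for j using sub by auto
    qed
    then have l: "filt ?P (sred x) \<in> ideal_of ?G"
      by (subst pol_expand) (auto intro!: is_ideal_sum[OF is_ideal_ideal_of] simp: keys_filt)
    obtain y where y: "filt (\<lambda>u. \<not> ?P u) (sred x) = var 0 * y"
      using v_dvdI[of "filt (\<lambda>u. \<not> ?P u) (sred x)"] by (auto simp: keys_filt)
    have sx: "sred x = filt ?P (sred x) + var 0 * y" using filt_split[of "sred x" ?P] y by simp
    have "sred x \<in> I" using sred_mem_iff[OF dbl_I] x by simp
    then have "var 0 * y \<in> I"
      using sx l LI is_ideal_add_cancel_left[OF I(1), of "filt ?P (sred x)" "var 0 * y"] by auto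
    then have "y \<in> I0" using I_sub_I0 I0_sat by blast
    then have "filt ?P (sred x) + var 0 * y \<in> ideal_of ?G"
      by (intro is_ideal_add[OF is_ideal_ideal_of l] vI0)
    then have "sred x \<in> ideal_of ?G" by (simp only: sx[symmetric])
    then show "x \<in> ideal_of ?G" using sred_mem_iff[OF dbl] by simp
  qed
qed

lemma generated_by_powers:
  "\<exists>a :: nat \<Rightarrow> nat. I = ideal_of (JR n s \<union> {var (2 * i - 1) ^ (2 ^ a i) | i. 1 \<le> i \<and> i \<le> r_of s})"
proof -
  \<comment> \<open>Such an exponent exists for every \<open>i \<ge> 1\<close>: the 2^s-th power of
    an odd generator represents a variable of index above s, which is a relation.\<close>
  define a where "a i = (LEAST k. var (2 * i - 1) ^ (2 ^ k) \<in> I)" for i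
  let ?G = "JR n s \<union> {var (2 * i - 1) ^ (2 ^ a i) | i. 1 \<le> i \<and> i \<le> r_of s}"
  have aI: "var (2 * i - 1) ^ (2 ^ a i) \<in> I" if i: "1 \<le> i" for i
    unfolding a_def
  proof (rule LeastI)
    have "s < 2 ^ s" by simp
    also have "\<dots> \<le> (2 * i - 1) * 2 ^ s" using i by simp
    finally have "var ((2 * i - 1) * 2 ^ s) \<in> I" using var_mem_JR I(2) by blast
    then show "var (2 * i - 1) ^ (2 ^ s) \<in> I" using dbl_closed_var_iff[OF dbl_I] i by simp
  qed
  have sub: "?G \<subseteq> ideal_of ?G" by (rule ideal_of_subset)
  have dbl: "dbl_closed (ideal_of ?G)" by (rule dbl_closed_JR[of _ n s]) (use sub in auto)
  have "ideal_of ?G \<subseteq> I" by (rule ideal_of_least[OF I(1)]) (use I(2) aI in auto)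
  moreover have "var j \<in> ideal_of ?G" if j: "j \<in> ZK" for j
  proof (cases "j \<le> s")
    case True
    have j1: "j \<ge> 1" using j by simp
    define k where "k = epart j"
    obtain q where "opart j = 2 * q + 1" using odd_opart[OF j1] by (rule oddE)
    then obtain i where i: "opart j = 2 * i - 1" "i \<ge> 1" by (intro that[of "q + 1"]) simp_all
    have je: "j = (2 * i - 1) * 2 ^ k" using opart_epart[OF j1] i by (simp add: k_def)
    have "2 * i - 1 \<le> j" unfolding je by simp
    then have ir: "i \<le> r_of s" using True i(2) by (simp add: r_of_def)
    have o1: "2 * i - 1 \<ge> 1" using i by simp
    have "var (2 * i - 1) ^ (2 ^ k) \<in> I"
      using var_ZK_mem_I[OF j] dbl_closed_var_iff[OF dbl_I o1] je by simp
    then have "a i \<le> k" unfolding a_def by (rule Least_le)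
    then have "(2::nat) ^ k = 2 ^ a i * 2 ^ (k - a i)" by (simp flip: power_add)
    then obtain c where c: "(2::nat) ^ k = 2 ^ a i + c" using le_Suc_ex[of "2 ^ a i" "2 ^ k"] \<open>a i \<le> k\<close> by auto
    have "var (2 * i - 1) ^ (2 ^ a i) \<in> ideal_of ?G" using sub ir i(2) by blast
    then have "var (2 * i - 1) ^ (2 ^ k) \<in> ideal_of ?G"
      unfolding c power_add by (rule is_ideal_mult_right[OF is_ideal_ideal_of])
    then show ?thesis using dbl_closed_var_iff[OF dbl o1] je by simp
  next
    case False
    then show ?thesis using var_mem_JR[of s j n] sub by auto
  qed
  then have "I \<subseteq> ideal_of ?G"
    by (subst generated_by_vars, intro ideal_of_mono) (use sub in auto)
  ultimately show ?thesis by (intro exI[of _ a]) blast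
qed

end

theorem theorem4p8:
  fixes n m :: nat and I :: "pol set"
  assumes "n \<ge> 1" and "m \<ge> 1"
    and "good_ideal n m I"
  shows "(\<exists>a :: nat \<Rightarrow> nat.
            I = ideal_of (JR n (s_of m) \<union>
                  {var (2 * i - 1) ^ (2 ^ a i) | i. 1 \<le> i \<and> i \<le> r_of (s_of m)}))
       \<and> (\<forall>I'. good_ideal n m I' \<and> ideal_of (I \<union> {var 0}) = ideal_of (I' \<union> {var 0})
               \<longrightarrow> I' = I)"
proof (intro conjI allI impI)
  interpret saturated_biideal n m I by standard (use assms in auto)
  show "\<exists>a :: nat \<Rightarrow> nat. I = ideal_of (JR n (s_of m) \<union>
      {var (2 * i - 1) ^ (2 ^ a i) | i. 1 \<le> i \<and> i \<le> r_of (s_of m)})"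
    by (rule generated_by_powers)
  fix I' assume I': "good_ideal n m I' \<and> ideal_of (I \<union> {var 0}) = ideal_of (I' \<union> {var 0})"
  interpret I': saturated_biideal n m I' by standard (use assms I' in auto)
  show "I' = I" using generated_by_vars I'.generated_by_vars I' by metis
qed

end
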